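(* Let $D\subset\mathbf R^n$ be a bounded domain with smooth boundary and let $u$ be a smooth convex function on $D$ (with positive definite Hessian in $D$), smooth up to the boundary of $D$, satisfying $S(u)=A$ in $D$, with $u<0$ in $D$ and $u=0$ on $\partial D$. For each Euclidean metric $g=(g_{ij})$ on $\mathbf R^n$ (a constant positive definite symmetric matrix) with determinant $1$, with inverse matrix $(g^{ij})$, let $C_g=\max_D g^{ij}u_iu_j$, and let $C=\min_g C_g$, the minimum being over all such $g$. Then $$\bigl(\det(u_{ij})\bigr)^{1/n}\le\left(\frac52+\frac{aM}{2n}\right)e\,C\,(-u)^{-1}$$ in $D$, where $a=\max\bigl(0,-\min_D A\bigr)$ and $M=\max_D(-u)$.
   Context: $u_i=\partial u/\partial x^i$, $u_{ij}=\partial^2u/\partial x^i\partial x^j$, $(u^{ij})$ is the inverse matrix of $(u_{ij})$, and $S(u)=-\sum_{i,j}\frac{\partial^2u^{ij}}{\partial x^i\partial x^j}$. The summation convention is used; $e$ is the base of natural logarithms. Maxima and minima over $D$ are to be understood as suprema and infima where necessary. *)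

theory Defs
  imports "HOL-Analysis.Analysis"
begin

definition partial :: "'n \<Rightarrow> (real ^ 'n \<Rightarrow> real) \<Rightarrow> real ^ 'n \<Rightarrow> real" where
  "partial i f x = deriv (\<lambda>t. f (x + t *\<^sub>R axis i 1)) 0"

primrec iter_partial :: "'n list \<Rightarrow> (real ^ 'n \<Rightarrow> real) \<Rightarrow> real ^ 'n \<Rightarrow> real" where
  "iter_partial [] f = f"
| "iter_partial (i # is) f = partial i (iter_partial is f)"

(* Meant for open W.  Each iterated partial derivative is totally differentiable, so all of
   them exist and are continuous: this is C^infinity on W. *)
definition smooth_on :: "(real ^ 'n) set \<Rightarrow> (real ^ 'n \<Rightarrow> real) \<Rightarrow> bool" where
  "smooth_on W f \<longleftrightarrow> (\<forall>is. iter_partial is f differentiable_on W)"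

(* C^infinity of the closure: all derivatives on D extend continuously to the closure, and f
   itself carries the boundary values of its extension. *)
definition smooth_up_to_boundary :: "(real ^ 'n) set \<Rightarrow> (real ^ 'n \<Rightarrow> real) \<Rightarrow> bool" where
  "smooth_up_to_boundary D f \<longleftrightarrow>
     smooth_on D f \<and> continuous_on (closure D) f \<and>
     (\<forall>is. \<exists>h. continuous_on (closure D) h \<and> (\<forall>x\<in>D. h x = iter_partial is f x))"

(* Near each boundary point, D is one side of a regular level set of a smooth function. *)
definition smooth_boundary :: "(real ^ 'n) set \<Rightarrow> bool" where
  "smooth_boundary D \<longleftrightarrow>
     (\<forall>p\<in>frontier D. \<exists>W \<rho>. open W \<and> p \<in> W \<and> smooth_on W \<rho> \<and>
        (\<forall>x\<in>W. \<exists>i. partial i \<rho> x \<noteq> 0) \<and> D \<inter> W = {x \<in> W. \<rho> x < 0})"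

definition hessian :: "(real ^ 'n \<Rightarrow> real) \<Rightarrow> real ^ 'n \<Rightarrow> real ^ 'n ^ 'n" where
  "hessian u x = (\<chi> i j. partial i (partial j u) x)"

definition pos_def_matrix :: "real ^ 'n ^ 'n \<Rightarrow> bool" where
  "pos_def_matrix g \<longleftrightarrow> transpose g = g \<and> (\<forall>v. v \<noteq> 0 \<longrightarrow> v \<bullet> (g *v v) > 0)"

definition abreu :: "(real ^ 'n \<Rightarrow> real) \<Rightarrow> real ^ 'n \<Rightarrow> real" where
  "abreu u x =
     - (\<Sum>i\<in>UNIV. \<Sum>j\<in>UNIV. partial i (partial j (\<lambda>y. matrix_inv (hessian u y) $ i $ j)) x)"

(* Suprema and infima are taken in the extended reals, so that no boundedness is presupposed. *)
definition grad_sup :: "(real ^ 'n) set \<Rightarrow> (real ^ 'n \<Rightarrow> real) \<Rightarrow> real ^ 'n ^ 'n \<Rightarrow> ereal" where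
  "grad_sup D u g =
     (SUP x\<in>D. ereal (\<Sum>i\<in>UNIV. \<Sum>j\<in>UNIV. matrix_inv g $ i $ j * partial i u x * partial j u x))"

definition min_grad_sup :: "(real ^ 'n) set \<Rightarrow> (real ^ 'n \<Rightarrow> real) \<Rightarrow> ereal" where
  "min_grad_sup D u = (INF g\<in>{g. pos_def_matrix g \<and> det g = 1}. grad_sup D u g)"

end

theory Submission
  imports Defs
begin

text \<open>
  Fix a constant metric \<open>g\<close> of determinant 1 and write \<open>G\<close> for its inverse,
  \<open>L = log det (u_ij)\<close>, \<open>h = G^ij u_i u_j\<close> and \<open>C_g = sup h\<close>.  The estimate for this one metric
  comes from the maximum principle applied to \<open>f = L + n log (-v) + \<alpha> h\<close> with \<open>v = u + \<epsilon>\<close>.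

  In terms of \<open>L\<close> the operator takes the form \<open>S(u) = u^ij L_ij - u^ij L_i L_j\<close> (lemma
  \<open>abreu_log_det\<close>).  At an interior maximum of \<open>f\<close> the gradient vanishes, which expresses \<open>L_i\<close>
  through \<open>u_i\<close> and \<open>h_i\<close>, and \<open>u^ij f_ij\<close> is nonpositive.  Since
  \<open>u^ij h_ij = 2 tr(G D\<^sup>2u) + 2 G^ij u_i L_j\<close>, all derivatives of \<open>L\<close> can be eliminated.  The terms
  quadratic in \<open>\<alpha>\<close> cancel, and the term in \<open>u^ij u_i u_j\<close> has the favourable coefficient
  \<open>n\<^sup>2 - n\<close>.  What remains (lemma \<open>inequality_at_maximum\<close>) is

    \<open>2 \<alpha> tr(G D\<^sup>2u) (-v) \<le> - S(u) (-v) + n\<^sup>2 + 2 n \<alpha> h\<close>.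

  The inequality between arithmetic and geometric means gives
  \<open>n (det u_ij)^(1/n) \<le> tr(G D\<^sup>2u)\<close> because \<open>det G = 1\<close>.  With \<open>\<alpha> = n / C_g\<close> the factor
  \<open>exp (\<alpha> h / n)\<close> varies between 1 and \<open>e\<close>, so the bound at the maximum spreads to the
  whole domain at the cost of a factor \<open>e\<close>.  This yields
  \<open>(det u_ij)^(1/n) (-u) \<le> e C_g (3/2 + a M / (2 n\<^sup>2))\<close>, which is at most the constant claimed.

  The shift by \<open>\<epsilon> > 0\<close> confines the argument to the sublevel set \<open>u \<le> -\<epsilon>\<close>, a compact subset of
  \<open>D\<close> on whose boundary the function \<open>(det u_ij)^(1/n) (-v) exp (\<alpha> h / n)\<close> vanishes; afterwards
  \<open>\<epsilon>\<close> tends to 0.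

  It remains to pass to the infimum over \<open>g\<close>.  If \<open>a\<close> is finite this is immediate.  If \<open>a\<close> is infinite,
  the right-hand side is infinite as soon as \<open>C > 0\<close>; this holds because the gradients of \<open>u\<close>
  span the whole space (lemma \<open>energy_uniform_lower_bound\<close>).
\<close>

section \<open>Symmetric and positive definite matrices\<close>

text \<open>A maximum point of the Rayleigh quotient on the unit sphere of an invariant subspace
  is an eigenvector.\<close>

lemma self_adjoint_eigenvector:
  fixes T :: "'a::euclidean_space \<Rightarrow> 'a"
  assumes lin: "linear T" and sa: "\<And>x y. x \<bullet> T y = T x \<bullet> y"
    and S: "subspace S" "S \<noteq> {0}" and inv: "\<And>x. x \<in> S \<Longrightarrow> T x \<in> S"
  obtains x l where "x \<in> S" "norm x = 1" "T x = l *\<^sub>R x"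
proof -
  obtain y where y: "y \<in> S" "y \<noteq> 0"
    using S subspace_0 by blast
  let ?K = "sphere 0 1 \<inter> S"
  have "(1 / norm y) *\<^sub>R y \<in> ?K"
    using y S by (simp add: subspace_scale)
  moreover have "compact ?K"
    using S(1) by (intro compact_Int_closed closed_subspace) auto
  moreover have "continuous_on ?K (\<lambda>x. x \<bullet> T x)"
    using lin by (intro continuous_intros linear_continuous_on linear_conv_bounded_linear[THEN iffD1])
  ultimately obtain x where x: "x \<in> ?K" and max: "\<And>z. z \<in> ?K \<Longrightarrow> z \<bullet> T z \<le> x \<bullet> T x"
    using continuous_attains_sup[of ?K "\<lambda>x. x \<bullet> T x"] by blast
  define l where "l = x \<bullet> T x"
  have xn: "norm x = 1" "x \<bullet> x = 1" and xS: "x \<in> S"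
    using x by (auto simp: norm_eq_1)
  have le: "z \<bullet> T z \<le> l * (z \<bullet> z)" if z: "z \<in> S" for z
  proof (cases "z = 0")
    case False
    then have "(1 / norm z) *\<^sub>R z \<in> ?K"
      using z S by (simp add: subspace_scale)
    from max[OF this] have "(z \<bullet> T z) / (norm z * norm z) \<le> l"
      by (simp add: linear_cmul[OF lin] l_def)
    then show ?thesis
      using False by (simp add: divide_le_eq dot_square_norm power2_eq_square)
  qed (simp add: linear_0[OF lin])
  \<comment> \<open>Moving from the maximum in the direction of the residual \<open>T x - l x\<close> would increase the
      quotient to first order, so the residual vanishes.\<close>
  define r where "r = T x - l *\<^sub>R x"
  have rS: "r \<in> S"
    unfolding r_def using S xS inv by (intro subspace_diff subspace_scale) auto
  have rx: "r \<bullet> x = 0"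
    by (simp add: r_def inner_diff_left l_def xn inner_commute[of "T x"])
  have rr: "r \<bullet> T x = r \<bullet> r" "T x \<bullet> r = r \<bullet> r"
    using rx by (simp_all add: r_def inner_diff_right inner_diff_left inner_commute)
  have quad: "2 * t * (r \<bullet> r) \<le> t\<^sup>2 * (l * (r \<bullet> r) - r \<bullet> T r)" for t
  proof -
    have "(x + t *\<^sub>R r) \<bullet> T (x + t *\<^sub>R r) \<le> l * ((x + t *\<^sub>R r) \<bullet> (x + t *\<^sub>R r))"
      using S xS rS by (intro le subspace_add subspace_scale) auto
    moreover have "(x + t *\<^sub>R r) \<bullet> T (x + t *\<^sub>R r) = l + 2 * t * (r \<bullet> r) + t\<^sup>2 * (r \<bullet> T r)"
      using rr sa[of x r]
      by (simp add: linear_add[OF lin] linear_cmul[OF lin] inner_add_left inner_add_right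
          l_def power2_eq_square algebra_simps)
    moreover have "(x + t *\<^sub>R r) \<bullet> (x + t *\<^sub>R r) = 1 + t\<^sup>2 * (r \<bullet> r)"
      using rx by (simp add: inner_add_left inner_add_right inner_commute xn power2_eq_square)
    ultimately have "l + 2 * t * (r \<bullet> r) + t\<^sup>2 * (r \<bullet> T r) \<le> l * (1 + t\<^sup>2 * (r \<bullet> r))"
      by metis
    then show ?thesis
      by (simp add: algebra_simps)
  qed
  have "r \<bullet> r = 0"
  proof (rule ccontr)
    assume "r \<bullet> r \<noteq> 0"
    then have pos: "r \<bullet> r > 0" by simp
    define c where "c = max 1 (l * (r \<bullet> r) - r \<bullet> T r)"
    have "c > 0" by (simp add: c_def)
    \<comment> \<open>The choice \<open>t = (r \<bullet> r) / c\<close> makes the linear term outweigh the quadratic one.\<close>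
    have "2 * ((r \<bullet> r) / c) * (r \<bullet> r) \<le> ((r \<bullet> r) / c)\<^sup>2 * c"
      using quad[of "(r \<bullet> r) / c"] c_def
      by (smt (verit) mult_left_mono zero_le_power2)
    then have "2 * (r \<bullet> r)\<^sup>2 / c \<le> (r \<bullet> r)\<^sup>2 / c"
      using \<open>c > 0\<close> by (simp add: power2_eq_square)
    then show False
      using pos \<open>c > 0\<close> by (simp add: divide_le_cancel)
  qed
  then have "T x = l *\<^sub>R x"
    by (simp add: r_def)
  with xS xn(1) show thesis by (rule that)
qed

text \<open>Split off one eigenvector and continue in its orthogonal complement, which is again
  invariant because the map is self-adjoint.\<close>

lemma self_adjoint_orthonormal_eigenbasis:
  fixes T :: "'a::euclidean_space \<Rightarrow> 'a"
  assumes lin: "linear T" and sa: "\<And>x y. x \<bullet> T y = T x \<bullet> y"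
    and "subspace S" "\<And>x. x \<in> S \<Longrightarrow> T x \<in> S"
  shows "\<exists>B. B \<subseteq> S \<and> pairwise orthogonal B \<and> (\<forall>x\<in>B. norm x = 1 \<and> (\<exists>l. T x = l *\<^sub>R x)) \<and> span B = S"
  using assms(3,4)
proof (induction "dim S" arbitrary: S rule: less_induct)
  case less
  show ?case
  proof (cases "S = {0}")
    case True
    then show ?thesis by (intro exI[of _ "{}"]) auto
  next
    case False
    obtain x l where x: "x \<in> S" "norm x = 1" "T x = l *\<^sub>R x"
      using self_adjoint_eigenvector[OF lin sa less.prems(1) False less.prems(2)] by metis
    define S' where "S' = S \<inter> {y. orthogonal x y}"
    have sub: "subspace S'"
      unfolding S'_def by (intro subspace_inter less.prems(1) subspace_orthogonal_to_vector)
    have xx: "x \<bullet> x = 1" using x by (simp add: norm_eq_1)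
    then have "x \<notin> S'" by (auto simp: S'_def orthogonal_def)
    then have "span S' \<subset> span S"
      using x sub less.prems(1) by (auto simp: S'_def span_eq_iff[THEN iffD2])
    then have "dim S' < dim S" by (rule dim_psubset)
    moreover have "T y \<in> S'" if "y \<in> S'" for y
      using that less.prems(2) sa[of x y] x by (auto simp: S'_def orthogonal_def)
    ultimately obtain B where B: "B \<subseteq> S'" "pairwise orthogonal B"
      "\<forall>x\<in>B. norm x = 1 \<and> (\<exists>l. T x = l *\<^sub>R x)" "span B = S'"
      using less.hyps sub by meson
    have "pairwise orthogonal (insert x B)"
      using B(1,2) by (auto simp: pairwise_insert S'_def orthogonal_commute)
    moreover have "span (insert x B) = S"
    proof
      show "span (insert x B) \<subseteq> S"
        using x B(1) less.prems(1) by (intro span_minimal) (auto simp: S'_def)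
      show "S \<subseteq> span (insert x B)"
      proof
        fix y assume y: "y \<in> S"
        have "y - (x \<bullet> y) *\<^sub>R x \<in> S'"
          using y x(1) less.prems(1)
          by (auto simp: S'_def orthogonal_def inner_diff_right xx intro: subspace_diff subspace_scale)
        then show "y \<in> span (insert x B)"
          using B(4) by (subst span_insert) auto
      qed
    qed
    ultimately show ?thesis
      using x B(1,3) by (intro exI[of _ "insert x B"]) (auto simp: S'_def)
  qed
qed

definition diag_matrix :: "('n \<Rightarrow> real) \<Rightarrow> real ^ 'n ^ 'n" where
  "diag_matrix d = (\<chi> i j. if i = j then d i else 0)"

lemma matrix_mult_diag: "(Q ** diag_matrix d) $ i $ j = Q $ i $ j * d j"
  by (simp add: matrix_matrix_mult_def diag_matrix_def if_distrib cong: if_cong)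

lemma symmetric_matrix_diagonalizable:
  fixes A :: "real ^ 'n ^ 'n"
  assumes "transpose A = A"
  obtains Q :: "real ^ 'n ^ 'n" and d
    where "orthogonal_matrix Q" "A = Q ** diag_matrix d ** transpose Q"
proof -
  have sa: "x \<bullet> (A *v y) = (A *v x) \<bullet> y" for x y
    by (metis assms dot_lmul_matrix transpose_matrix_vector)
  obtain B where B: "pairwise orthogonal B" "\<forall>x\<in>B. norm x = 1 \<and> (\<exists>l. A *v x = l *\<^sub>R x)"
      "span B = (UNIV :: (real ^ 'n) set)"
    using self_adjoint_orthonormal_eigenbasis[of "(*v) A" UNIV] sa by auto
  have "0 \<notin> B" using B(2) by force
  then have ind: "independent B"
    using B(1) by (intro pairwise_orthogonal_independent)
  have "card B = CARD('n)"
    using dim_eq_card[OF _ ind, of UNIV] B(3) by simp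
  then obtain f where f: "bij_betw f (UNIV :: 'n set) B"
    by (metis finite_class.finite_UNIV finite_same_card_bij independent_imp_finite ind)
  have "\<exists>l. A *v f j = l *\<^sub>R f j" for j
    using B(2) f by (auto dest: bij_betwE)
  then obtain d where d: "\<And>j. A *v f j = d j *\<^sub>R f j" by metis
  define Q :: "real ^ 'n ^ 'n" where "Q = (\<chi> i j. f j $ i)"
  have col: "column j Q = f j" for j
    by (simp add: Q_def column_def)
  have orth: "orthogonal_matrix Q"
    unfolding orthogonal_matrix_orthonormal_columns col
    using B(1,2) f unfolding bij_betw_def pairwise_def inj_on_def by (metis UNIV_I imageI)
  have "A ** Q = Q ** diag_matrix d"
  proof (simp add: vec_eq_iff matrix_mult_diag, intro allI)
    fix i j
    have "(A ** Q) $ i $ j = (A *v f j) $ i"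
      by (simp add: matrix_matrix_mult_def matrix_vector_mult_def Q_def)
    then show "(A ** Q) $ i $ j = Q $ i $ j * d j"
      by (simp add: d Q_def)
  qed
  then have "A = Q ** diag_matrix d ** transpose Q"
    using matrix_mul_assoc[of A Q "transpose Q"] orth unfolding orthogonal_matrix_def by simp
  with orth show thesis
    by (intro that)
qed

lemma det_diag_matrix: "det (diag_matrix d) = (\<Prod>i\<in>UNIV. d i)"
  by (subst det_diagonal) (auto simp: diag_matrix_def)

lemma det_orthogonal_conj:
  fixes Q :: "real ^ 'n ^ 'n"
  assumes "orthogonal_matrix Q"
  shows "det (Q ** X ** transpose Q) = det X"
  using assms det_orthogonal_matrix[OF assms] by (auto simp: det_mul det_transpose)

lemma quadratic_form_matrix: "v \<bullet> (A *v v) = (\<Sum>i\<in>UNIV. \<Sum>j\<in>UNIV. A $ i $ j * v $ i * v $ j)"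
  for A :: "real ^ 'n ^ 'n"
  by (simp add: inner_vec_def matrix_vector_mult_def sum_distrib_left mult_ac)

text \<open>Each eigenvalue is the value of the quadratic form at the corresponding column of
  \<open>Q\<close>, hence positive.\<close>

lemma pos_def_diagonalizable:
  fixes A :: "real ^ 'n ^ 'n"
  assumes "pos_def_matrix A"
  obtains Q :: "real ^ 'n ^ 'n" and d
    where "orthogonal_matrix Q" "A = Q ** diag_matrix d ** transpose Q" "\<And>i. d i > 0"
proof -
  obtain Q :: "real ^ 'n ^ 'n" and d where Q: "orthogonal_matrix Q" and A: "A = Q ** diag_matrix d ** transpose Q"
    using assms symmetric_matrix_diagonalizable unfolding pos_def_matrix_def by metis
  have "d i > 0" for i
  proof -
    let ?v = "Q *v axis i 1"
    have tv: "transpose Q *v ?v = axis i 1"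
      using Q by (simp add: matrix_vector_mul_assoc orthogonal_matrix)
    then have "?v \<noteq> 0" by (metis axis_eq_0_iff matrix_vector_mult_0_right zero_neq_one)
    then have "?v \<bullet> (A *v ?v) > 0"
      using assms by (simp add: pos_def_matrix_def)
    also have "A *v ?v = Q *v (diag_matrix d *v axis i 1)"
      unfolding A by (simp only: tv flip: matrix_vector_mul_assoc)
    also have "?v \<bullet> (Q *v (diag_matrix d *v axis i 1)) = axis i 1 \<bullet> (diag_matrix d *v axis i 1)"
      by (metis dot_lmul_matrix transpose_matrix_vector transpose_transpose tv)
    also have "\<dots> = d i"
      by (simp add: inner_axis' matrix_vector_mult_basis column_def diag_matrix_def)
    finally show ?thesis .
  qed
  with Q A show thesis by (rule that)
qed

lemma pos_def_factor:
  fixes A :: "real ^ 'n ^ 'n"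
  assumes "pos_def_matrix A"
  obtains B :: "real ^ 'n ^ 'n" where "A = B ** transpose B"
proof -
  obtain Q :: "real ^ 'n ^ 'n" and d where Q: "A = Q ** diag_matrix d ** transpose Q" and d: "\<And>i. d i > 0"
    using pos_def_diagonalizable[OF assms] by metis
  define R :: "real ^ 'n ^ 'n" where "R = diag_matrix (\<lambda>i. sqrt (d i))"
  have "transpose R = R"
    by (simp add: R_def diag_matrix_def transpose_def vec_eq_iff)
  moreover have "R ** R = diag_matrix d"
    using d by (simp add: vec_eq_iff R_def matrix_mult_diag)
      (simp add: diag_matrix_def less_imp_le)
  ultimately have "A = (Q ** R) ** transpose (Q ** R)"
    unfolding Q matrix_transpose_mul by (simp add: matrix_mul_assoc[symmetric])
      (simp add: matrix_mul_assoc)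
  then show thesis by (rule that)
qed

lemma pos_def_det_pos:
  fixes A :: "real ^ 'n ^ 'n"
  assumes "pos_def_matrix A"
  shows "det A > 0"
  using pos_def_diagonalizable[OF assms]
  by (metis det_orthogonal_conj det_diag_matrix prod_pos)

lemma pos_def_invertible: "pos_def_matrix (A :: real ^ 'n ^ 'n) \<Longrightarrow> invertible A"
  using pos_def_det_pos[of A] by (simp add: invertible_det_nz)

lemma pos_def_inverse_mult:
  fixes A :: "real ^ 'n ^ 'n"
  assumes "pos_def_matrix A"
  shows "A ** matrix_inv A = mat 1" "matrix_inv A ** A = mat 1"
  using pos_def_invertible[OF assms] unfolding invertible_def matrix_inv_def
  by (metis (mono_tags, lifting) someI_ex)+

lemma pos_def_matrix_inv:
  fixes A :: "real ^ 'n ^ 'n"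
  assumes A: "pos_def_matrix A"
  shows "pos_def_matrix (matrix_inv A)"
proof -
  note inv = pos_def_inverse_mult[OF A]
  have symA: "transpose A = A" using A by (simp add: pos_def_matrix_def)
  have "transpose (matrix_inv A) ** A = mat 1"
    using inv(1) matrix_transpose_mul[of A "matrix_inv A"] by (simp add: symA)
  then have sym: "transpose (matrix_inv A) = matrix_inv A"
    using matrix_mul_assoc[of "transpose (matrix_inv A)" A "matrix_inv A"] by (simp add: inv)
  moreover have "v \<bullet> (matrix_inv A *v v) > 0" if "v \<noteq> 0" for v
  proof -
    let ?w = "matrix_inv A *v v"
    have Aw: "A *v ?w = v" by (simp add: matrix_vector_mul_assoc inv)
    then have "?w \<noteq> 0" using that by auto
    then have "?w \<bullet> (A *v ?w) > 0" using A by (simp add: pos_def_matrix_def)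
    then show ?thesis by (simp add: Aw inner_commute)
  qed
  ultimately show ?thesis by (simp add: pos_def_matrix_def)
qed

lemma arith_geom_mean_pos_def:
  fixes A :: "real ^ 'n ^ 'n"
  assumes "pos_def_matrix A"
  shows "real CARD('n) * det A powr (1 / real CARD('n)) \<le> trace A"
proof -
  obtain Q :: "real ^ 'n ^ 'n" and d where Q: "orthogonal_matrix Q" "A = Q ** diag_matrix d ** transpose Q"
    and d: "\<And>i. d i > 0"
    using pos_def_diagonalizable[OF assms] by metis
  have "trace A = trace (transpose Q ** (Q ** diag_matrix d))"
    using trace_mul_sym[of "Q ** diag_matrix d" "transpose Q"] by (simp add: Q)
  also have "\<dots> = trace (diag_matrix d)"
    using Q(1) by (simp add: matrix_mul_assoc orthogonal_matrix)
  also have "\<dots> = (\<Sum>i\<in>UNIV. d i)"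
    by (simp add: trace_def diag_matrix_def)
  finally have tr: "trace A = (\<Sum>i\<in>UNIV. d i)" .
  have "det A = (\<Prod>i\<in>UNIV. d i)"
    by (simp add: Q det_orthogonal_conj det_diag_matrix)
  then have "det A powr (1 / real CARD('n)) \<le> (\<Sum>i\<in>UNIV. d i / real CARD('n))"
    using arith_geom_mean[of UNIV "d"] d
    by (simp add: less_imp_le powr_def root_powr_inverse sum_divide_distrib prod_pos)
  then show ?thesis
    by (simp add: tr field_simps flip: sum_divide_distrib)
qed

lemma trace_conj_sum:
  fixes B N :: "real ^ 'n ^ 'n"
  shows "trace (B ** transpose B ** N) = (\<Sum>k\<in>UNIV. column k B \<bullet> (N *v column k B))"
proof -
  have "trace (B ** transpose B ** N) = trace (transpose B ** (N ** B))"
    using trace_mul_sym[of B "transpose B ** N"] by (simp add: matrix_mul_assoc)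
  also have "\<dots> = (\<Sum>k\<in>UNIV. column k B \<bullet> (N *v column k B))"
    by (simp add: trace_def matrix_matrix_mult_def transpose_def column_def inner_vec_def
        matrix_vector_mult_def)
  finally show ?thesis .
qed

text \<open>This is the form in which the second derivative test will be used: \<open>P = B B\<^sup>T\<close> turns
  \<open>tr(P N)\<close> into a sum of values of the quadratic form of \<open>N\<close>.\<close>

lemma trace_pos_def_mult_nonpos:
  fixes P N :: "real ^ 'n ^ 'n"
  assumes "pos_def_matrix P" and "\<And>v. v \<bullet> (N *v v) \<le> 0"
  shows "trace (P ** N) \<le> 0"
proof -
  obtain B :: "real ^ 'n ^ 'n" where "P = B ** transpose B"
    using pos_def_factor[OF assms(1)] .
  then show ?thesis
    using assms(2) by (simp only: trace_conj_sum) (intro sum_nonpos)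
qed

text \<open>The product \<open>G H\<close> is not symmetric, but with \<open>G = B B\<^sup>T\<close> it has the same trace and
  determinant as the positive definite matrix \<open>B\<^sup>T H B\<close>.\<close>

lemma arith_geom_mean_trace_mult:
  fixes G H :: "real ^ 'n ^ 'n"
  assumes G: "pos_def_matrix G" and H: "pos_def_matrix H"
  shows "real CARD('n) * (det G * det H) powr (1 / real CARD('n)) \<le> trace (G ** H)"
proof -
  obtain B :: "real ^ 'n ^ 'n" where B: "G = B ** transpose B" using pos_def_factor[OF G] .
  define X where "X = transpose B ** H ** B"
  have "det G \<noteq> 0" using pos_def_det_pos[OF G] by simp
  then have "invertible B"
    by (auto simp: B det_mul invertible_det_nz)
  then have inj: "B *v v \<noteq> 0" if "v \<noteq> 0" for v
    using that matrix_left_invertible_ker unfolding invertible_left_inverse by metis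
  have quad: "v \<bullet> (X *v v) = (B *v v) \<bullet> (H *v (B *v v))" for v
    unfolding X_def
    by (simp only: dot_lmul_matrix transpose_matrix_vector flip: matrix_vector_mul_assoc)
      (metis dot_lmul_matrix inner_commute)
  have "pos_def_matrix X"
    unfolding pos_def_matrix_def
  proof (intro conjI allI impI)
    show "transpose X = X"
      using H by (simp add: X_def pos_def_matrix_def matrix_transpose_mul matrix_mul_assoc)
    show "0 < v \<bullet> (X *v v)" if "v \<noteq> 0" for v
      using H inj[OF that] by (simp add: quad pos_def_matrix_def)
  qed
  from arith_geom_mean_pos_def[OF this] show ?thesis
    using trace_mul_sym[of B "transpose B ** H"] by (simp add: X_def B det_mul mult_ac matrix_mul_assoc)
qed

lemma trace_mult: "trace (A ** B) = (\<Sum>i\<in>UNIV. \<Sum>j\<in>UNIV. A $ i $ j * B $ j $ i)"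
  for A B :: "real ^ 'n ^ 'n"
  by (simp add: trace_def matrix_matrix_mult_def)

lemma symmetric_matrix_nth: "transpose A = A \<Longrightarrow> A $ i $ j = A $ j $ i"
  by (metis transpose_def vec_lambda_beta)

lemma symmetric_matrix_inner:
  fixes A :: "real ^ 'n ^ 'n"
  shows "transpose A = A \<Longrightarrow> (A *v v) \<bullet> w = v \<bullet> (A *v w)"
  by (metis dot_lmul_matrix transpose_matrix_vector)

section \<open>Calculus of partial derivatives\<close>

lemma partial_eq_derivative:
  assumes "(f has_derivative f') (at x)"
  shows "partial i f x = f' (axis i 1)"
proof -
  have lin: "linear f'" using assms has_derivative_linear by blast
  have "((\<lambda>t. f (x + t *\<^sub>R axis i 1)) has_derivative (\<lambda>t. f' (t *\<^sub>R axis i 1))) (at 0)"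
    by (rule has_derivative_compose[of "\<lambda>t. x + t *\<^sub>R axis i 1" "\<lambda>t. t *\<^sub>R axis i 1" 0 UNIV f f'])
      (auto intro!: derivative_eq_intros assms)
  then have "((\<lambda>t. f (x + t *\<^sub>R axis i 1)) has_field_derivative f' (axis i 1)) (at 0)"
    by (simp add: has_field_derivative_def linear_cmul[OF lin] mult.commute[of _ "f' _"])
  then show ?thesis
    unfolding partial_def by (rule DERIV_imp_deriv)
qed

definition gradient :: "(real ^ 'n \<Rightarrow> real) \<Rightarrow> real ^ 'n \<Rightarrow> real ^ 'n" where
  "gradient f x = (\<chi> i. partial i f x)"

lemma has_derivative_gradient:
  fixes f :: "real ^ 'n \<Rightarrow> real"
  assumes "f differentiable (at x)"
  shows "(f has_derivative (\<lambda>y. gradient f x \<bullet> y)) (at x)"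
proof -
  obtain f' where f': "(f has_derivative f') (at x)"
    using assms differentiable_def by blast
  then interpret linear f' using has_derivative_linear by blast
  have "f' y = gradient f x \<bullet> y" for y
  proof -
    have "f' y = f' (\<Sum>i\<in>UNIV. (y $ i) *\<^sub>R axis i 1)"
      by (simp add: basis_expansion flip: scalar_mult_eq_scaleR)
    also have "\<dots> = gradient f x \<bullet> y"
      by (simp add: sum scale gradient_def inner_vec_def partial_eq_derivative[OF f'] mult.commute)
    finally show ?thesis .
  qed
  then have "f' = (\<lambda>y. gradient f x \<bullet> y)" by auto
  with f' show ?thesis by simp
qed

lemma partial_cong_open:
  assumes "open S" "x \<in> S" "\<And>y. y \<in> S \<Longrightarrow> f y = g y"
  shows "partial i f x = partial i g x"
proof -
  have "eventually (\<lambda>t. x + t *\<^sub>R axis i 1 \<in> S) (nhds 0)"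
    using assms(1,2) by (intro topological_tendstoD[of "\<lambda>t. x + t *\<^sub>R axis i 1" x])
      (auto intro!: tendsto_eq_intros simp: filterlim_ident)
  then have "eventually (\<lambda>t. f (x + t *\<^sub>R axis i 1) = g (x + t *\<^sub>R axis i 1)) (nhds 0)"
    by eventually_elim (use assms in auto)
  then show ?thesis
    unfolding partial_def by (rule deriv_cong_ev) simp
qed

lemma differentiable_cong_open:
  assumes "f differentiable (at x)" "open S" "x \<in> S" "\<And>y. y \<in> S \<Longrightarrow> f y = g y"
  shows "g differentiable (at x)"
  using assms has_derivative_transform_within_open unfolding differentiable_def by blast

context
  fixes f g :: "real ^ 'n \<Rightarrow> real" and x :: "real ^ 'n"
  assumes f: "f differentiable (at x)" and g: "g differentiable (at x)"
begin

lemma partial_add: "partial i (\<lambda>y. f y + g y) x = partial i f x + partial i g x"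
  using partial_eq_derivative[OF has_derivative_add[OF has_derivative_gradient[OF f] has_derivative_gradient[OF g]], of i]
  by (simp add: gradient_def inner_axis)

lemma partial_mult: "partial i (\<lambda>y. f y * g y) x = partial i f x * g x + f x * partial i g x"
  using partial_eq_derivative[OF has_derivative_mult[OF has_derivative_gradient[OF f] has_derivative_gradient[OF g]], of i]
  by (simp add: gradient_def inner_axis)

end

lemma partial_const: "partial i (\<lambda>y. c) x = 0"
  by (simp add: partial_def)

lemma partial_cmult:
  "f differentiable (at x) \<Longrightarrow> partial i (\<lambda>y. c * f y) x = c * partial i f x"
  by (simp add: partial_mult partial_const)

lemma partial_uminus:
  "f differentiable (at x) \<Longrightarrow> partial i (\<lambda>y. - f y) x = - partial i f x"
  using partial_cmult[of f x i "-1"] by simp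

lemma partial_sum:
  "(\<And>k. k \<in> K \<Longrightarrow> f k differentiable (at x)) \<Longrightarrow>
    partial i (\<lambda>y. \<Sum>k\<in>K. f k y) x = (\<Sum>k\<in>K. partial i (f k) x)"
proof (induction K rule: infinite_finite_induct)
  case (insert k K)
  then show ?case
    by (simp add: partial_add differentiable_sum)
qed (simp_all add: partial_const)

lemma partial_chain:
  fixes f :: "real ^ 'n \<Rightarrow> real"
  assumes "f differentiable (at x)" "(\<phi> has_real_derivative d) (at (f x))"
  shows "partial i (\<lambda>y. \<phi> (f y)) x = d * partial i f x"
    and "(\<lambda>y. \<phi> (f y)) differentiable (at x)"
proof -
  have "((\<lambda>y. \<phi> (f y)) has_derivative (\<lambda>y. d * (gradient f x \<bullet> y))) (at x)"
    using has_derivative_compose[OF has_derivative_gradient[OF assms(1)]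
        assms(2)[unfolded has_field_derivative_def]] .
  then show "partial i (\<lambda>y. \<phi> (f y)) x = d * partial i f x" "(\<lambda>y. \<phi> (f y)) differentiable (at x)"
    using partial_eq_derivative[of "\<lambda>y. \<phi> (f y)" _ x i]
    by (auto simp: gradient_def inner_axis differentiable_def)
qed

lemma partial_prod:
  fixes f :: "'k \<Rightarrow> real ^ 'n \<Rightarrow> real"
  assumes "\<And>k. k \<in> K \<Longrightarrow> f k differentiable (at x)"
  shows "partial i (\<lambda>y. \<Prod>k\<in>K. f k y) x = (\<Sum>k\<in>K. partial i (f k) x * (\<Prod>j\<in>K - {k}. f j x))"
    and "(\<lambda>y. \<Prod>k\<in>K. f k y) differentiable (at x)"
proof -
  have "((\<lambda>y. \<Prod>k\<in>K. f k y) has_derivative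
      (\<lambda>y. \<Sum>k\<in>K. (gradient (f k) x \<bullet> y) * (\<Prod>j\<in>K - {k}. f j x))) (at x)"
    using assms by (intro has_derivative_prod has_derivative_gradient)
  then show "partial i (\<lambda>y. \<Prod>k\<in>K. f k y) x = (\<Sum>k\<in>K. partial i (f k) x * (\<Prod>j\<in>K - {k}. f j x))"
    and "(\<lambda>y. \<Prod>k\<in>K. f k y) differentiable (at x)"
    using partial_eq_derivative[of "\<lambda>y. \<Prod>k\<in>K. f k y" _ x i]
    by (auto simp: gradient_def inner_axis differentiable_def)
qed

text \<open>The second difference over the square with side \<open>t\<close> is, by the mean value theorem in the
  direction \<open>i\<close>, \<open>t\<close> times a difference of values of \<open>\<partial>\<^sub>i f\<close>; differentiability of \<open>\<partial>\<^sub>i f\<close> at the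
  single point \<open>p\<close> then identifies the limit.  The second difference is symmetric in \<open>i\<close> and \<open>j\<close>,
  so this gives the symmetry of mixed partial derivatives.\<close>

lemma partial_symmetric_aux:
  fixes f :: "real ^ 'n \<Rightarrow> real"
  assumes S: "open S" "p \<in> S" and f: "\<And>x. x \<in> S \<Longrightarrow> f differentiable (at x)"
    and fi: "partial i f differentiable (at p)"
  shows "((\<lambda>t. (f (p + t *\<^sub>R axis i 1 + t *\<^sub>R axis j 1) - f (p + t *\<^sub>R axis i 1)
      - f (p + t *\<^sub>R axis j 1) + f p) / t\<^sup>2) \<longlongrightarrow> partial j (partial i f) p) (at_right 0)"
    (is "(?\<phi> \<longlongrightarrow> ?L) _")
proof (rule tendstoI)
  fix e :: real assume e: "e > 0"
  let ?a = "axis i 1 :: real ^ 'n" and ?b = "axis j 1 :: real ^ 'n"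
  define F where "F = gradient (partial i f) p"
  have "(partial i f has_derivative (\<lambda>y. F \<bullet> y)) (at p)"
    using has_derivative_gradient[OF fi] by (simp add: F_def)
  then obtain d1 where d1: "d1 > 0" and
    d1': "\<And>y. norm (y - p) < d1 \<Longrightarrow> norm (partial i f y - partial i f p - F \<bullet> (y - p)) \<le> e / 4 * norm (y - p)"
    using e unfolding has_derivative_within_alt by (metis UNIV_I divide_pos_pos zero_less_numeral)
  obtain d2 where d2: "d2 > 0" "ball p d2 \<subseteq> S"
    using S openE by blast
  have "\<bar>?\<phi> t - ?L\<bar> < e" if t: "0 < t" "t < min d1 d2 / 2" for t
  proof -
    have norm1: "norm (s *\<^sub>R ?a + r *\<^sub>R ?b) \<le> s + r" if "0 \<le> s" "0 \<le> r" for s r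
      using norm_triangle_ineq[of "s *\<^sub>R ?a" "r *\<^sub>R ?b"] that by simp
    have inS: "p + s *\<^sub>R ?a + r *\<^sub>R ?b \<in> S" if "0 \<le> s" "s \<le> t" "0 \<le> r" "r \<le> t" for s r
    proof -
      have "norm (s *\<^sub>R ?a + r *\<^sub>R ?b) < d2" using norm1[of s r] that t by linarith
      then have "p + s *\<^sub>R ?a + r *\<^sub>R ?b \<in> ball p d2"
        by (metis add.assoc add_diff_cancel_left' dist_commute dist_norm mem_ball)
      then show ?thesis using d2 by blast
    qed
    have der: "((\<lambda>s. f (p + s *\<^sub>R ?a + r *\<^sub>R ?b)) has_real_derivative partial i f (p + s *\<^sub>R ?a + r *\<^sub>R ?b)) (at s)"
      if "0 \<le> s" "s \<le> t" "0 \<le> r" "r \<le> t" for s r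
    proof -
      have "((\<lambda>s. f (p + s *\<^sub>R ?a + r *\<^sub>R ?b)) has_derivative
          (\<lambda>h. gradient f (p + s *\<^sub>R ?a + r *\<^sub>R ?b) \<bullet> (h *\<^sub>R ?a))) (at s)"
        by (rule has_derivative_compose[of "\<lambda>s. p + s *\<^sub>R ?a + r *\<^sub>R ?b" "\<lambda>h. h *\<^sub>R ?a"])
          (auto intro!: derivative_eq_intros has_derivative_gradient f inS that)
      then show ?thesis
        by (simp add: has_field_derivative_def gradient_def inner_axis mult.commute[of _ "partial _ _ _"])
    qed
    \<comment> \<open>The term \<open>0 *\<^sub>R axis j 1\<close> is kept so that both summands are instances of the same
        derivative rule.\<close>
    define g where "g s = f (p + s *\<^sub>R ?a + t *\<^sub>R ?b) - f (p + s *\<^sub>R ?a + 0 *\<^sub>R ?b)" for s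
    have "\<exists>z>0. z < t \<and> g t - g 0 = (t - 0) * (partial i f (p + z *\<^sub>R ?a + t *\<^sub>R ?b) - partial i f (p + z *\<^sub>R ?a + 0 *\<^sub>R ?b))"
      unfolding g_def using t by (intro MVT2 DERIV_diff der) auto
    then obtain z where z: "0 < z" "z < t" and
      gz: "g t - g 0 = t * (partial i f (p + z *\<^sub>R ?a + t *\<^sub>R ?b) - partial i f (p + z *\<^sub>R ?a + 0 *\<^sub>R ?b))"
      by auto
    have est: "\<bar>partial i f (p + z *\<^sub>R ?a + r *\<^sub>R ?b) - partial i f p - (z * (F \<bullet> ?a) + r * (F \<bullet> ?b))\<bar> \<le> e / 4 * (z + r)"
      if "0 \<le> r" "r \<le> t" for r
    proof -
      have n: "norm (z *\<^sub>R ?a + r *\<^sub>R ?b) \<le> z + r" using z that by (intro norm1) auto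
      then have "norm (z *\<^sub>R ?a + r *\<^sub>R ?b) < d1" using z that t by linarith
      then have "\<bar>partial i f (p + z *\<^sub>R ?a + r *\<^sub>R ?b) - partial i f p - F \<bullet> (z *\<^sub>R ?a + r *\<^sub>R ?b)\<bar>
          \<le> e / 4 * norm (z *\<^sub>R ?a + r *\<^sub>R ?b)"
        using d1'[of "p + z *\<^sub>R ?a + r *\<^sub>R ?b"] by (simp add: add.assoc)
      also have "\<dots> \<le> e / 4 * (z + r)" using e n by (intro mult_left_mono) auto
      finally show ?thesis by (simp add: inner_add_right)
    qed
    have "\<bar>partial i f (p + z *\<^sub>R ?a + t *\<^sub>R ?b) - partial i f (p + z *\<^sub>R ?a + 0 *\<^sub>R ?b) - t * (F \<bullet> ?b)\<bar>
        \<le> e / 4 * (z + t) + e / 4 * (z + 0)"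
      using est[of t] est[of 0] t by linarith
    also have "\<dots> = e / 4 * (2 * z + t)" by (simp add: field_simps)
    also have "\<dots> < e / 4 * (4 * t)" using e z t by (intro mult_strict_left_mono) auto
    finally have est2: "\<bar>partial i f (p + z *\<^sub>R ?a + t *\<^sub>R ?b) - partial i f (p + z *\<^sub>R ?a + 0 *\<^sub>R ?b) - t * (F \<bullet> ?b)\<bar> < e * t"
      by simp
    have "?\<phi> t = (g t - g 0) / t\<^sup>2" by (simp add: g_def)
    then have "?\<phi> t - ?L = (partial i f (p + z *\<^sub>R ?a + t *\<^sub>R ?b) - partial i f (p + z *\<^sub>R ?a + 0 *\<^sub>R ?b) - t * (F \<bullet> ?b)) / t"
      unfolding gz F_def gradient_def using t
      by (simp add: inner_axis power2_eq_square diff_divide_distrib)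
    then show ?thesis using est2 t by (simp add: pos_divide_less_eq)
  qed
  then show "eventually (\<lambda>t. dist (?\<phi> t) ?L < e) (at_right 0)"
    unfolding eventually_at_right_field dist_real_def
    using d1 d2 by (intro exI[of _ "min d1 d2 / 2"]) auto
qed

lemma partial_symmetric:
  fixes f :: "real ^ 'n \<Rightarrow> real"
  assumes "open S" "p \<in> S" "\<And>x. x \<in> S \<Longrightarrow> f differentiable (at x)"
    and "partial i f differentiable (at p)" "partial j f differentiable (at p)"
  shows "partial i (partial j f) p = partial j (partial i f) p"
proof -
  have "((\<lambda>t. (f (p + t *\<^sub>R axis i 1 + t *\<^sub>R axis j 1) - f (p + t *\<^sub>R axis i 1)
      - f (p + t *\<^sub>R axis j 1) + f p) / t\<^sup>2) \<longlongrightarrow> partial i (partial j f) p) (at_right 0)"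
    using partial_symmetric_aux[OF assms(1-3,5), of i] by (simp add: algebra_simps)
  then show ?thesis
    using partial_symmetric_aux[OF assms(1-4), of j] tendsto_unique trivial_limit_at_right_real
    by blast
qed

text \<open>Restricting to the line through \<open>p\<close> in the direction \<open>v\<close> reduces the claim to one
  variable.  If the second derivative there were positive, the first derivative would be positive
  just to the right of 0, so the function would exceed its maximum.\<close>

lemma second_derivative_nonpos_at_max:
  fixes f :: "real ^ 'n \<Rightarrow> real"
  assumes S: "open S" "p \<in> S" and f: "\<And>x. x \<in> S \<Longrightarrow> f differentiable (at x)"
    and f2: "\<And>k. partial k f differentiable (at p)"
    and max: "\<And>x. x \<in> S \<Longrightarrow> f x \<le> f p"
  shows "partial k f p = 0"
    and "v \<bullet> ((\<chi> i j. partial i (partial j f) p) *v v) \<le> 0"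
proof -
  obtain r where r: "r > 0" "ball p r \<subseteq> S" using S openE by blast
  have "(\<lambda>y. gradient f p \<bullet> y) = (\<lambda>y. 0)"
    using r max by (intro differential_zero_maxmin[of p S f] has_derivative_gradient f S) auto
  then have "gradient f p \<bullet> axis k 1 = 0" for k by metis
  then have crit: "partial k f p = 0" for k by (simp add: gradient_def inner_axis)
  then show "partial k f p = 0" .
  define \<phi> where "\<phi> t = f (p + t *\<^sub>R v)" for t :: real
  define \<psi> where "\<psi> t = (\<Sum>k\<in>UNIV. partial k f (p + t *\<^sub>R v) * v $ k)" for t :: real
  have "((\<lambda>t. p + t *\<^sub>R v) \<longlongrightarrow> p) (nhds 0)"
    by (auto intro!: tendsto_eq_intros simp: filterlim_ident)
  then have "eventually (\<lambda>t. p + t *\<^sub>R v \<in> S) (nhds 0)"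
    using S by (rule topological_tendstoD)
  then obtain d where d: "d > 0" "\<And>t. \<bar>t\<bar> < d \<Longrightarrow> p + t *\<^sub>R v \<in> S"
    unfolding eventually_nhds_metric by (auto simp: dist_real_def)
  have \<phi>': "(\<phi> has_real_derivative \<psi> t) (at t)" if "\<bar>t\<bar> < d" for t
  proof -
    have "(\<phi> has_derivative (\<lambda>h. gradient f (p + t *\<^sub>R v) \<bullet> (h *\<^sub>R v))) (at t)"
      unfolding \<phi>_def
      by (rule has_derivative_compose[of "\<lambda>t. p + t *\<^sub>R v" "\<lambda>h. h *\<^sub>R v"])
        (auto intro!: derivative_eq_intros has_derivative_gradient f d(2) that)
    moreover have "\<psi> t = gradient f (p + t *\<^sub>R v) \<bullet> v"
      by (simp add: \<psi>_def gradient_def inner_vec_def)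
    ultimately show ?thesis
      by (simp add: has_field_derivative_def mult.commute[of _ "_ \<bullet> _"])
  qed
  have q: "((\<lambda>t. partial k f (p + t *\<^sub>R v)) has_real_derivative (\<Sum>i\<in>UNIV. partial i (partial k f) p * v $ i)) (at 0)" for k
  proof -
    have "((\<lambda>t. partial k f (p + t *\<^sub>R v)) has_derivative (\<lambda>h. gradient (partial k f) p \<bullet> (h *\<^sub>R v))) (at 0)"
      by (rule has_derivative_compose[of "\<lambda>t. p + t *\<^sub>R v" "\<lambda>h. h *\<^sub>R v"])
        (auto intro!: derivative_eq_intros has_derivative_gradient f2)
    moreover have "(\<Sum>i\<in>UNIV. partial i (partial k f) p * v $ i) = gradient (partial k f) p \<bullet> v"
      by (simp add: gradient_def inner_vec_def)
    ultimately show ?thesis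
      by (simp add: has_field_derivative_def mult.commute[of _ "_ \<bullet> _"])
  qed
  define c where "c = v \<bullet> ((\<chi> i j. partial i (partial j f) p) *v v)"
  have c: "c = (\<Sum>k\<in>UNIV. (\<Sum>i\<in>UNIV. partial i (partial k f) p * v $ i) * v $ k)"
    unfolding c_def quadratic_form_matrix
    by (subst sum.swap) (simp add: sum_distrib_right)
  have \<psi>': "(\<psi> has_real_derivative c) (at 0)"
    unfolding \<psi>_def c by (intro DERIV_sum DERIV_cmult_right q)
  show "c \<le> 0"
  proof (rule ccontr)
    assume "\<not> c \<le> 0"
    then obtain d' where d': "d' > 0" "\<And>h. 0 < h \<Longrightarrow> h < d' \<Longrightarrow> \<psi> 0 < \<psi> (0 + h)"
      using DERIV_pos_inc_right[OF \<psi>'] by auto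
    have "\<psi> 0 = 0" by (simp add: \<psi>_def crit)
    define t where "t = min d d' / 2"
    have t: "0 < t" "t < d" "t < d'" using d d' by (auto simp: t_def)
    have "\<exists>z>0. z < t \<and> \<phi> t - \<phi> 0 = (t - 0) * \<psi> z"
      using t by (intro MVT2 \<phi>') auto
    then obtain z where "0 < z" "z < t" "\<phi> t - \<phi> 0 = t * \<psi> z" by auto
    then have "\<phi> t - \<phi> 0 > 0"
      using d'(2)[of z] t \<open>\<psi> 0 = 0\<close> by simp
    moreover have "\<phi> t \<le> \<phi> 0" using max[OF d(2), of t] t by (simp add: \<phi>_def)
    ultimately show False by simp
  qed
qed

text \<open>Jacobi's formula.  The product rule in the Leibniz formula gives a sum of determinants
  in which one row is replaced by its derivative; writing that row as a combination of the rows of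
  \<open>M x\<close>, Cramer's rule evaluates each of them.\<close>

lemma partial_det:
  fixes M :: "real ^ 'm \<Rightarrow> real ^ 'n ^ 'n"
  assumes diff: "\<And>i j. (\<lambda>y. M y $ i $ j) differentiable (at x)"
  shows "(\<lambda>y. det (M y)) differentiable (at x)" (is ?D)
    and "M x ** P = mat 1 \<Longrightarrow>
      partial k (\<lambda>y. det (M y)) x = det (M x) * (\<Sum>i\<in>UNIV. \<Sum>j\<in>UNIV. P $ j $ i * partial k (\<lambda>y. M y $ i $ j) x)"
proof -
  note pr = partial_prod[of UNIV "\<lambda>i y. M y $ i $ (p i)" x for p, OF diff]
  show ?D
    unfolding det_def using pr(2) by (intro differentiable_sum differentiable_cmult_left_iff[THEN iffD2] disjI2 ballI) (auto intro!: derivative_intros)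
  assume inv: "M x ** P = mat 1"
  let ?d = "\<lambda>i j. partial k (\<lambda>y. M y $ i $ j) x"
  have "partial k (\<lambda>y. det (M y)) x = (\<Sum>p\<in>{p. p permutes UNIV}. of_int (sign p) *
      (\<Sum>i\<in>UNIV. ?d i (p i) * (\<Prod>j\<in>UNIV - {i}. M x $ j $ p j)))"
    unfolding det_def using pr by (subst partial_sum) (auto intro!: derivative_intros simp: partial_cmult)
  also have "\<dots> = (\<Sum>i\<in>UNIV. \<Sum>p\<in>{p. p permutes UNIV}. of_int (sign p) *
      (?d i (p i) * (\<Prod>j\<in>UNIV - {i}. M x $ j $ p j)))"
    by (subst sum.swap) (simp add: sum_distrib_left)
  also have "\<dots> = (\<Sum>i\<in>UNIV. det (\<chi> r c. if r = i then ?d i c else M x $ r $ c))"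
  proof -
    have "(\<Prod>r\<in>UNIV. if r = i then ?d i (p r) else M x $ r $ p r) = ?d i (p i) * (\<Prod>j\<in>UNIV - {i}. M x $ j $ p j)" for i p
      by (subst prod.remove[of UNIV i]) auto
    then show ?thesis by (simp add: det_def)
  qed
  also have "\<dots> = (\<Sum>i\<in>UNIV. (\<Sum>j\<in>UNIV. P $ j $ i * ?d i j) * det (M x))"
  proof (rule sum.cong[OF refl])
    fix i
    define w :: "real ^ 'n" where "w = (\<chi> c. ?d i c)"
    define v where "v = transpose P *v w"
    have "transpose (M x) *v v = w"
      using inv matrix_transpose_mul[of P "M x"] matrix_left_right_inverse
      by (metis matrix_vector_mul_assoc matrix_vector_mul_lid transpose_mat v_def)
    then have "det (\<chi> r c. if r = i then ?d i c else M x $ r $ c)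
        = det (\<chi> c r. if r = i then (transpose (M x) *v v) $ c else transpose (M x) $ c $ r)"
      by (subst det_transpose[symmetric]) (simp add: transpose_def w_def if_distrib cong: if_cong)
    also have "\<dots> = v $ i * det (M x)"
      by (simp add: cramer_lemma det_transpose)
    also have "v $ i = (\<Sum>j\<in>UNIV. P $ j $ i * ?d i j)"
      by (simp add: v_def w_def matrix_vector_mult_def transpose_def)
    finally show "det (\<chi> r c. if r = i then ?d i c else M x $ r $ c) = (\<Sum>j\<in>UNIV. P $ j $ i * ?d i j) * det (M x)" .
  qed
  finally show "partial k (\<lambda>y. det (M y)) x = det (M x) * (\<Sum>i\<in>UNIV. \<Sum>j\<in>UNIV. P $ j $ i * ?d i j)"
    by (simp add: sum_distrib_left mult_ac)
qed

text \<open>Cramer's rule shows that the entries of the inverse are differentiable.  Their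
  derivatives then follow by differentiating \<open>M M\<^sup>-\<^sup>1 = 1\<close>.\<close>

lemma partial_matrix_inv:
  fixes M :: "real ^ 'm \<Rightarrow> real ^ 'n ^ 'n"
  assumes S: "open S" "x \<in> S" and inv: "\<And>y. y \<in> S \<Longrightarrow> invertible (M y)"
    and diff: "\<And>i j. (\<lambda>y. M y $ i $ j) differentiable (at x)"
  shows "(\<lambda>y. matrix_inv (M y) $ i $ j) differentiable (at x)"
    and "partial k (\<lambda>y. matrix_inv (M y) $ i $ j) x = - (\<Sum>a\<in>UNIV. \<Sum>b\<in>UNIV.
      matrix_inv (M x) $ i $ a * partial k (\<lambda>y. M y $ a $ b) x * matrix_inv (M x) $ b $ j)"
proof -
  have mi: "M y ** matrix_inv (M y) = mat 1" "matrix_inv (M y) ** M y = mat 1" if "y \<in> S" for y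
    using inv[OF that] unfolding invertible_def matrix_inv_def
    by (metis (mono_tags, lifting) someI_ex)+
  have det: "det (M y) \<noteq> 0" if "y \<in> S" for y
    using inv[OF that] by (simp add: invertible_det_nz)
  define c where "c i j y = det (\<chi> r s. if s = i then axis j 1 $ r else M y $ r $ s)" for i j :: 'n and y
  have cr: "c i j y / det (M y) = matrix_inv (M y) $ i $ j" if "y \<in> S" for y i j
  proof -
    have "M y *v column j (matrix_inv (M y)) = axis j 1"
      using mi(1)[OF that] by (metis matrix_vector_mul_assoc matrix_vector_mul_lid matrix_vector_mult_basis)
    then have "column j (matrix_inv (M y)) = (\<chi> k. det (\<chi> r s. if s = k then axis j 1 $ r else M y $ r $ s) / det (M y))"
      using cramer[OF det[OF that]] by blast
    then show ?thesis by (simp add: vec_eq_iff column_def c_def)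
  qed
  have "c i j differentiable (at x)" for i j
    unfolding c_def
  proof (rule partial_det(1))
    fix r s
    show "(\<lambda>y. (\<chi> r s. if s = i then axis j 1 $ r else M y $ r $ s) $ r $ s) differentiable (at x)"
      by (cases "s = i") (simp_all add: diff)
  qed
  then have "(\<lambda>y. c i j y / det (M y)) differentiable (at x)" for i j
    using det[OF S(2)] by (intro differentiable_divide partial_det(1) diff)
  then show diffI: "(\<lambda>y. matrix_inv (M y) $ i $ j) differentiable (at x)" for i j
    by (rule differentiable_cong_open[OF _ S]) (rule cr)
  let ?P = "matrix_inv (M x)"
  have d0: "(\<Sum>b\<in>UNIV. partial k (\<lambda>y. M y $ a $ b) x * ?P $ b $ j)
      + (\<Sum>b\<in>UNIV. M x $ a $ b * partial k (\<lambda>y. matrix_inv (M y) $ b $ j) x) = 0" for a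
  proof -
    have "partial k (\<lambda>y. \<Sum>b\<in>UNIV. M y $ a $ b * matrix_inv (M y) $ b $ j) x = partial k (\<lambda>y. mat 1 $ a $ j) x"
      by (rule partial_cong_open[OF S]) (simp add: matrix_matrix_mult_def flip: mi(1))
    also have "\<dots> = 0" by (rule partial_const)
    finally show ?thesis
      by (simp add: partial_sum partial_mult diff diffI differentiable_mult sum.distrib)
  qed
  have "partial k (\<lambda>y. matrix_inv (M y) $ i $ j) x
      = (\<Sum>b\<in>UNIV. (?P ** M x) $ i $ b * partial k (\<lambda>y. matrix_inv (M y) $ b $ j) x)"
    by (simp add: mi S mat_def if_distrib[of "\<lambda>x. x * _"] cong: if_cong)
  also have "\<dots> = (\<Sum>a\<in>UNIV. ?P $ i $ a * (\<Sum>b\<in>UNIV. M x $ a $ b * partial k (\<lambda>y. matrix_inv (M y) $ b $ j) x))"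
    unfolding matrix_matrix_mult_def
    by (simp add: sum_distrib_left sum_distrib_right mult.assoc) (rule sum.swap)
  also have "\<dots> = (\<Sum>a\<in>UNIV. ?P $ i $ a * - (\<Sum>b\<in>UNIV. partial k (\<lambda>y. M y $ a $ b) x * ?P $ b $ j))"
    using d0 by (intro sum.cong refl arg_cong2[of _ _ _ _ "(*)"]) (simp add: eq_neg_iff_add_eq_0 add.commute)
  also have "\<dots> = - (\<Sum>a\<in>UNIV. \<Sum>b\<in>UNIV. ?P $ i $ a * partial k (\<lambda>y. M y $ a $ b) x * ?P $ b $ j)"
    by (simp add: sum_distrib_left sum_negf mult.assoc)
  finally show "partial k (\<lambda>y. matrix_inv (M y) $ i $ j) x = - (\<Sum>a\<in>UNIV. \<Sum>b\<in>UNIV.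
      ?P $ i $ a * partial k (\<lambda>y. M y $ a $ b) x * ?P $ b $ j)" .
qed

section \<open>The equation in terms of the logarithm of the determinant\<close>

locale convex_potential =
  fixes D :: "(real ^ 'n) set" and u :: "real ^ 'n \<Rightarrow> real"
  assumes open_domain: "open D" and smooth: "smooth_on D u"
    and pos_def: "\<And>x. x \<in> D \<Longrightarrow> pos_def_matrix (hessian u x)"
begin

definition third :: "'n \<Rightarrow> 'n \<Rightarrow> 'n \<Rightarrow> real ^ 'n \<Rightarrow> real" where
  "third i j k = partial i (partial j (partial k u))"

definition inv_hessian :: "real ^ 'n \<Rightarrow> real ^ 'n ^ 'n" where
  "inv_hessian x = matrix_inv (hessian u x)"

definition log_det :: "real ^ 'n \<Rightarrow> real" where
  "log_det x = ln (det (hessian u x))"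

lemma differentiable_iter_partial: "x \<in> D \<Longrightarrow> iter_partial is u differentiable (at x)"
  using smooth open_domain unfolding smooth_on_def differentiable_on_def by (metis at_within_open)

lemma differentiable_partials:
  assumes "x \<in> D"
  shows "u differentiable (at x)" "partial i u differentiable (at x)"
    "partial i (partial j u) differentiable (at x)" "third i j k differentiable (at x)"
  using differentiable_iter_partial[OF assms, of "[]"] differentiable_iter_partial[OF assms, of "[i]"]
    differentiable_iter_partial[OF assms, of "[i, j]"] differentiable_iter_partial[OF assms, of "[i, j, k]"]
  by (simp_all add: third_def)

lemma hessian_nth: "hessian u x $ i $ j = partial i (partial j u) x"
  by (simp add: hessian_def)

lemma second_symmetric: "x \<in> D \<Longrightarrow> partial i (partial j u) x = partial j (partial i u) x"
  by (rule partial_symmetric[OF open_domain]) (auto intro: differentiable_partials)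

lemma third_symmetric:
  assumes "x \<in> D"
  shows "third i j k x = third j i k x" "third i j k x = third i k j x"
  unfolding third_def
  using assms differentiable_partials(4) unfolding third_def
  by (auto intro!: partial_symmetric[OF open_domain] partial_cong_open[OF open_domain]
      differentiable_partials second_symmetric)

lemma inv_hessian_mult:
  assumes "x \<in> D"
  shows "hessian u x ** inv_hessian x = mat 1" "inv_hessian x ** hessian u x = mat 1"
  using pos_def_inverse_mult[OF pos_def[OF assms]] by (simp_all add: inv_hessian_def)

lemma pos_def_inv_hessian: "x \<in> D \<Longrightarrow> pos_def_matrix (inv_hessian x)"
  using pos_def_matrix_inv[OF pos_def] by (simp add: inv_hessian_def)

lemma inv_hessian_symmetric:
  assumes "x \<in> D"
  shows "inv_hessian x $ i $ j = inv_hessian x $ j $ i"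
proof -
  have "transpose (inv_hessian x) = inv_hessian x"
    using pos_def_inv_hessian[OF assms] by (simp add: pos_def_matrix_def)
  then show ?thesis by (metis (no_types) transpose_def vec_lambda_beta)
qed

lemma differentiable_inv_hessian: "x \<in> D \<Longrightarrow> (\<lambda>y. inv_hessian y $ i $ j) differentiable (at x)"
  unfolding inv_hessian_def
  by (rule partial_matrix_inv(1)[OF open_domain])
    (auto simp: hessian_nth intro: pos_def_invertible pos_def differentiable_partials)

lemma partial_inv_hessian:
  assumes "x \<in> D"
  shows "partial k (\<lambda>y. inv_hessian y $ i $ j) x
    = - (\<Sum>a\<in>UNIV. \<Sum>b\<in>UNIV. inv_hessian x $ i $ a * third k a b x * inv_hessian x $ b $ j)"
  unfolding inv_hessian_def third_def
  by (subst partial_matrix_inv(2)[OF open_domain assms])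
    (auto simp: hessian_nth intro: pos_def_invertible pos_def differentiable_partials assms)

lemma log_det_derivative:
  assumes "x \<in> D"
  shows "log_det differentiable (at x)"
    and "partial k log_det x = (\<Sum>i\<in>UNIV. \<Sum>j\<in>UNIV. inv_hessian x $ i $ j * third k i j x)"
proof -
  have diff: "(\<lambda>y. hessian u y $ i $ j) differentiable (at x)" for i j
    using assms by (simp add: hessian_nth differentiable_partials)
  have pos: "det (hessian u x) > 0"
    by (intro pos_def_det_pos pos_def assms)
  have ln: "(ln has_real_derivative 1 / det (hessian u x)) (at (det (hessian u x)))"
    using pos by (auto intro!: derivative_eq_intros)
  note chain = partial_chain[OF partial_det(1)[of "hessian u", OF diff] ln]
  show "log_det differentiable (at x)"
    using chain(2) by (simp add: log_det_def[abs_def])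
  have "partial k log_det x = (\<Sum>i\<in>UNIV. \<Sum>j\<in>UNIV. inv_hessian x $ j $ i * third k i j x)"
    using chain(1)[of k] partial_det(2)[of "hessian u", OF diff inv_hessian_mult(1)[OF assms], of k] pos
    by (simp add: log_det_def[abs_def] hessian_nth third_def)
  then show "partial k log_det x = (\<Sum>i\<in>UNIV. \<Sum>j\<in>UNIV. inv_hessian x $ i $ j * third k i j x)"
    by (simp add: inv_hessian_symmetric[OF assms])
qed

lemma differentiable_partial_log_det:
  assumes "x \<in> D"
  shows "partial k log_det differentiable (at x)"
  by (rule differentiable_cong_open[OF _ open_domain assms, of
        "\<lambda>x. \<Sum>i\<in>UNIV. \<Sum>j\<in>UNIV. inv_hessian x $ i $ j * third k i j x"])
    (auto intro!: differentiable_sum differentiable_mult differentiable_inv_hessian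
      differentiable_partials assms simp: log_det_derivative)

text \<open>By the symmetry of the third derivatives, the contraction that arises from
  differentiating the inverse Hessian is the one in the derivative of \<open>log det\<close>.\<close>

lemma divergence_inv_hessian:
  assumes "x \<in> D"
  shows "(\<Sum>j\<in>UNIV. partial j (\<lambda>y. inv_hessian y $ i $ j) x)
    = - (\<Sum>a\<in>UNIV. inv_hessian x $ i $ a * partial a log_det x)"
proof -
  have "(\<Sum>j\<in>UNIV. partial j (\<lambda>y. inv_hessian y $ i $ j) x)
      = - (\<Sum>j\<in>UNIV. \<Sum>a\<in>UNIV. inv_hessian x $ i $ a * (\<Sum>b\<in>UNIV. inv_hessian x $ j $ b * third a j b x))"
    using third_symmetric(1)[OF assms] inv_hessian_symmetric[OF assms]
    by (simp add: partial_inv_hessian[OF assms] sum_negf sum_distrib_left mult_ac)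
  also have "\<dots> = - (\<Sum>a\<in>UNIV. inv_hessian x $ i $ a * partial a log_det x)"
    by (subst sum.swap) (simp add: log_det_derivative[OF assms] sum_distrib_left)
  finally show ?thesis .
qed

text \<open>Abreu's operator is in divergence form: by the preceding lemma it equals
  \<open>\<partial>\<^sub>i (u^ia L_a)\<close> with \<open>L = log det (u_ij)\<close>.  Carrying out the outer derivative produces the
  second order term and, by the same lemma again, the quadratic gradient term.\<close>

lemma abreu_log_det:
  assumes x: "x \<in> D"
  shows "abreu u x = trace (inv_hessian x ** (\<chi> i j. partial i (partial j log_det) x))
    - gradient log_det x \<bullet> (inv_hessian x *v gradient log_det x)"
proof -
  note diffs = differentiable_inv_hessian differentiable_partial_log_det differentiable_partials
  \<comment> \<open>The inner derivatives have to be differentiable before the sum over \<open>j\<close> can be pulled inside.\<close>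
  have dP: "partial j (\<lambda>y. inv_hessian y $ i $ j) differentiable (at x)" for i j
    by (rule differentiable_cong_open[OF _ open_domain x, of "\<lambda>x. - (\<Sum>a\<in>UNIV. \<Sum>b\<in>UNIV. inv_hessian x $ i $ a * third j a b x * inv_hessian x $ b $ j)"])
      (auto intro!: differentiable_sum differentiable_mult differentiable_minus diffs x simp: partial_inv_hessian)
  let ?L = "\<lambda>a. partial a log_det"
  have "abreu u x = (\<Sum>i\<in>UNIV. - partial i (\<lambda>y. \<Sum>j\<in>UNIV. partial j (\<lambda>y. inv_hessian y $ i $ j) y) x)"
    unfolding abreu_def inv_hessian_def[symmetric]
    by (simp add: partial_sum dP sum_negf)
  also have "\<dots> = (\<Sum>i\<in>UNIV. partial i (\<lambda>y. \<Sum>a\<in>UNIV. inv_hessian y $ i $ a * ?L a y) x)"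
  proof (rule sum.cong[OF refl])
    fix i
    have "partial i (\<lambda>y. \<Sum>j\<in>UNIV. partial j (\<lambda>y. inv_hessian y $ i $ j) y) x
        = partial i (\<lambda>y. - (\<Sum>a\<in>UNIV. inv_hessian y $ i $ a * ?L a y)) x"
      by (rule partial_cong_open[OF open_domain x]) (rule divergence_inv_hessian)
    also have "\<dots> = - partial i (\<lambda>y. \<Sum>a\<in>UNIV. inv_hessian y $ i $ a * ?L a y) x"
      by (intro partial_uminus differentiable_sum differentiable_mult diffs x ballI) auto
    finally show "- partial i (\<lambda>y. \<Sum>j\<in>UNIV. partial j (\<lambda>y. inv_hessian y $ i $ j) y) x
        = partial i (\<lambda>y. \<Sum>a\<in>UNIV. inv_hessian y $ i $ a * ?L a y) x" by simp
  qed
  also have "\<dots> = (\<Sum>i\<in>UNIV. \<Sum>a\<in>UNIV. partial i (\<lambda>y. inv_hessian y $ i $ a) x * ?L a x)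
      + (\<Sum>i\<in>UNIV. \<Sum>a\<in>UNIV. inv_hessian x $ i $ a * partial i (?L a) x)"
    by (simp add: partial_sum partial_mult differentiable_mult diffs x sum.distrib)
  also have "(\<Sum>i\<in>UNIV. \<Sum>a\<in>UNIV. partial i (\<lambda>y. inv_hessian y $ i $ a) x * ?L a x)
      = (\<Sum>a\<in>UNIV. (\<Sum>i\<in>UNIV. partial i (\<lambda>y. inv_hessian y $ a $ i) x) * ?L a x)"
  proof -
    have "partial i (\<lambda>y. inv_hessian y $ i $ a) x = partial i (\<lambda>y. inv_hessian y $ a $ i) x" for i a
      by (rule partial_cong_open[OF open_domain x]) (rule inv_hessian_symmetric)
    then show ?thesis by (subst sum.swap) (simp add: sum_distrib_right)
  qed
  also have "\<dots> = - (gradient log_det x \<bullet> (inv_hessian x *v gradient log_det x))"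
    by (simp add: divergence_inv_hessian[OF x] inner_vec_def matrix_vector_mult_def gradient_def
        sum_negf mult.commute)
  also have "(\<Sum>i\<in>UNIV. \<Sum>a\<in>UNIV. inv_hessian x $ i $ a * partial i (?L a) x)
      = trace (inv_hessian x ** (\<chi> i j. partial i (partial j log_det) x))"
    by (subst sum.swap) (simp add: trace_def matrix_matrix_mult_def inv_hessian_symmetric[OF x])
  finally show ?thesis by simp
qed

section \<open>The maximum principle\<close>

text \<open>The squared length of the differential of \<open>u\<close>.  The matrix \<open>G\<close> stands for the inverse
  \<open>g^ij\<close> of the metric.\<close>

definition energy :: "real ^ 'n ^ 'n \<Rightarrow> real ^ 'n \<Rightarrow> real" where
  "energy G x = (\<Sum>i\<in>UNIV. \<Sum>j\<in>UNIV. G $ i $ j * partial i u x * partial j u x)"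

lemma energy_eq: "energy G x = gradient u x \<bullet> (G *v gradient u x)"
  by (simp add: energy_def quadratic_form_matrix gradient_def)

lemma energy_nonneg: "pos_def_matrix G \<Longrightarrow> energy G x \<ge> 0"
  unfolding energy_eq pos_def_matrix_def by (cases "gradient u x = 0") (auto simp: less_imp_le)

lemma energy_derivative:
  assumes G: "transpose G = G" and x: "x \<in> D"
  shows "energy G differentiable (at x)"
    and "partial k (energy G) x = (\<Sum>i\<in>UNIV. \<Sum>j\<in>UNIV. 2 * G $ i $ j * (partial i u x * partial k (partial j u) x))"
proof -
  note d = differentiable_partials[OF x]
  show "energy G differentiable (at x)"
    unfolding energy_def[abs_def] using d by (auto intro!: differentiable_sum differentiable_mult)
  have "partial k (energy G) x = (\<Sum>i\<in>UNIV. \<Sum>j\<in>UNIV. G $ i $ j * (partial i u x * partial k (partial j u) x))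
      + (\<Sum>i\<in>UNIV. \<Sum>j\<in>UNIV. G $ i $ j * (partial j u x * partial k (partial i u) x))"
    unfolding energy_def[abs_def]
    by (simp add: partial_sum partial_mult partial_cmult partial_const differentiable_sum differentiable_mult d
        sum.distrib[symmetric] algebra_simps)
  also have "(\<Sum>i\<in>UNIV. \<Sum>j\<in>UNIV. G $ i $ j * (partial j u x * partial k (partial i u) x))
      = (\<Sum>i\<in>UNIV. \<Sum>j\<in>UNIV. G $ i $ j * (partial i u x * partial k (partial j u) x))"
    by (subst sum.swap) (simp add: symmetric_matrix_nth[OF G])
  finally show "partial k (energy G) x = (\<Sum>i\<in>UNIV. \<Sum>j\<in>UNIV. 2 * G $ i $ j * (partial i u x * partial k (partial j u) x))"
    by (simp add: sum.distrib[symmetric] mult_ac)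
qed

lemma gradient_energy:
  assumes G: "transpose G = G" and x: "x \<in> D"
  shows "gradient (energy G) x = 2 *\<^sub>R (hessian u x *v (G *v gradient u x))"
proof -
  have "(\<Sum>i\<in>UNIV. \<Sum>j\<in>UNIV. 2 * G $ i $ j * (partial i u x * partial k (partial j u) x))
      = (\<Sum>j\<in>UNIV. \<Sum>i\<in>UNIV. 2 * (partial k (partial j u) x * (G $ j $ i * partial i u x)))" for k
    by (subst sum.swap) (simp add: symmetric_matrix_nth[OF G] mult_ac)
  then show ?thesis
    by (simp add: vec_eq_iff gradient_def energy_derivative(2)[OF G x] matrix_vector_mult_def
        hessian_nth sum_distrib_left)
qed

lemma second_energy:
  assumes G: "transpose G = G" and x: "x \<in> D"
  shows "partial k (energy G) differentiable (at x)"
    and "partial l (partial k (energy G)) x = (\<Sum>i\<in>UNIV. \<Sum>j\<in>UNIV. 2 * G $ i $ j *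
      (partial l (partial i u) x * partial k (partial j u) x + partial i u x * third l k j x))"
proof -
  note d = differentiable_partials
  let ?e = "\<lambda>x. \<Sum>i\<in>UNIV. \<Sum>j\<in>UNIV. 2 * G $ i $ j * (partial i u x * partial k (partial j u) x)"
  show "partial k (energy G) differentiable (at x)"
    by (rule differentiable_cong_open[OF _ open_domain x, of ?e])
      (auto intro!: differentiable_sum differentiable_mult d x simp: energy_derivative[OF G])
  have "partial l (partial k (energy G)) x = partial l ?e x"
    by (rule partial_cong_open[OF open_domain x]) (rule energy_derivative[OF G])
  then show "partial l (partial k (energy G)) x = (\<Sum>i\<in>UNIV. \<Sum>j\<in>UNIV. 2 * G $ i $ j *
      (partial l (partial i u) x * partial k (partial j u) x + partial i u x * third l k j x))"
    by (simp add: partial_sum partial_cmult partial_mult differentiable_sum differentiable_mult d x third_def)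
qed

text \<open>The terms with two second derivatives of \<open>u\<close> collapse because the inverse Hessian cancels
  one of them.  In the terms with third derivatives the contraction is the gradient of
  \<open>log det\<close>; this coupling drives the cancellation in \<open>inequality_at_maximum\<close>.\<close>

lemma trace_second_energy:
  assumes G: "transpose G = G" and x: "x \<in> D"
  shows "trace (inv_hessian x ** (\<chi> i j. partial i (partial j (energy G)) x))
    = 2 * trace (G ** hessian u x) + 2 * ((G *v gradient u x) \<bullet> gradient log_det x)"
proof -
  let ?P = "inv_hessian x" and ?H = "hessian u x"
  let ?U = "\<lambda>i j. partial i (partial j u) x"
  have 1: "(\<Sum>a\<in>UNIV. \<Sum>b\<in>UNIV. ?P $ a $ b * (?U b i * ?U a j)) = ?U i j" for i j
  proof -
    have "(\<Sum>a\<in>UNIV. \<Sum>b\<in>UNIV. ?P $ a $ b * (?U b i * ?U a j)) = (\<Sum>a\<in>UNIV. ?U a j * (?P ** ?H) $ a $ i)"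
      by (simp add: matrix_matrix_mult_def hessian_nth sum_distrib_left mult_ac)
    then show ?thesis
      by (simp add: inv_hessian_mult[OF x] mat_def if_distrib cong: if_cong)
  qed
  have 2: "(\<Sum>a\<in>UNIV. \<Sum>b\<in>UNIV. ?P $ a $ b * third b a j x) = partial j log_det x" for j
  proof -
    have "third b a j x = third j a b x" for a b
      using third_symmetric[OF x] by metis
    then show ?thesis by (simp add: log_det_derivative[OF x])
  qed
  have "trace (?P ** (\<chi> i j. partial i (partial j (energy G)) x))
    = (\<Sum>a\<in>UNIV. \<Sum>b\<in>UNIV. \<Sum>i\<in>UNIV. \<Sum>j\<in>UNIV. 2 * G $ i $ j * (?P $ a $ b * (?U b i * ?U a j)
        + partial i u x * (?P $ a $ b * third b a j x)))"
    by (simp add: trace_mult second_energy[OF G x] sum_distrib_left algebra_simps)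
  also have "\<dots> = (\<Sum>i\<in>UNIV. \<Sum>j\<in>UNIV. \<Sum>a\<in>UNIV. \<Sum>b\<in>UNIV. 2 * G $ i $ j * (?P $ a $ b * (?U b i * ?U a j)
        + partial i u x * (?P $ a $ b * third b a j x)))"
  proof -
    have "(\<Sum>a\<in>A. \<Sum>b\<in>A. \<Sum>i\<in>A. \<Sum>j\<in>A. F a b i j) = (\<Sum>i\<in>A. \<Sum>j\<in>A. \<Sum>a\<in>A. \<Sum>b\<in>A. F a b i j)"
      for A :: "'n set" and F :: "'n \<Rightarrow> 'n \<Rightarrow> 'n \<Rightarrow> 'n \<Rightarrow> real"
    proof -
      have "(\<Sum>a\<in>A. \<Sum>b\<in>A. \<Sum>i\<in>A. \<Sum>j\<in>A. F a b i j) = (\<Sum>i\<in>A. \<Sum>a\<in>A. \<Sum>b\<in>A. \<Sum>j\<in>A. F a b i j)"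
        by (subst sum.swap[of _ A A]) (intro sum.cong refl sum.swap)
      also have "\<dots> = (\<Sum>i\<in>A. \<Sum>j\<in>A. \<Sum>a\<in>A. \<Sum>b\<in>A. F a b i j)"
        by (rule sum.cong[OF refl], subst sum.swap[of _ A A]) (intro sum.cong refl sum.swap)
      finally show ?thesis .
    qed
    then show ?thesis .
  qed
  also have "\<dots> = (\<Sum>i\<in>UNIV. \<Sum>j\<in>UNIV. 2 * G $ i $ j * (?U i j + partial i u x * partial j log_det x))"
    by (simp add: 1 2 sum.distrib flip: sum_distrib_left)
  also have "\<dots> = 2 * trace (G ** ?H) + 2 * ((G *v gradient u x) \<bullet> gradient log_det x)"
  proof -
    have "(G *v gradient u x) \<bullet> gradient log_det x = gradient u x \<bullet> (G *v gradient log_det x)"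
      by (rule symmetric_matrix_inner[OF G])
    then show ?thesis
      by (simp add: trace_mult inner_vec_def matrix_vector_mult_def gradient_def hessian_nth
          second_symmetric[OF x] sum_distrib_left sum.distrib algebra_simps)
  qed
  finally show ?thesis .
qed

definition log_height :: "real \<Rightarrow> real ^ 'n \<Rightarrow> real" where
  "log_height \<epsilon> x = ln (- (u x + \<epsilon>))"

lemma continuous_on_potential: "continuous_on D u"
  by (intro continuous_at_imp_continuous_on ballI differentiable_imp_continuous_within differentiable_partials)

lemma open_sublevel: "open {y \<in> D. u y + \<epsilon> < 0}"
proof -
  have "{y \<in> D. u y + \<epsilon> < 0} = D \<inter> u -` {..<- \<epsilon>}" by auto
  then show ?thesis
    using continuous_open_preimage[OF continuous_on_potential open_domain open_lessThan] by simp
qed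

lemma log_height_derivative:
  assumes x: "x \<in> D" and neg: "u x + \<epsilon> < 0"
  shows "log_height \<epsilon> differentiable (at x)"
    and "partial k (log_height \<epsilon>) x = partial k u x * inverse (u x + \<epsilon>)"
proof -
  have ln: "((\<lambda>t. ln (- (t + \<epsilon>))) has_real_derivative inverse (u x + \<epsilon>)) (at (u x))"
    using neg by (auto intro!: derivative_eq_intros simp: field_simps)
  show "log_height \<epsilon> differentiable (at x)"
    "partial k (log_height \<epsilon>) x = partial k u x * inverse (u x + \<epsilon>)"
    using partial_chain[OF differentiable_partials(1)[OF x] ln]
    by (auto simp: mult.commute log_height_def[abs_def])
qed

lemma second_log_height:
  assumes x: "x \<in> D" and neg: "u x + \<epsilon> < 0"
  shows "partial k (log_height \<epsilon>) differentiable (at x)"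
    and "partial l (partial k (log_height \<epsilon>)) x
      = partial l (partial k u) x / (u x + \<epsilon>) - partial l u x * partial k u x / (u x + \<epsilon>)\<^sup>2"
proof -
  note d = differentiable_partials[OF x]
  define S where "S = {y \<in> D. u y + \<epsilon> < 0}"
  have S: "open S" "x \<in> S"
    using open_sublevel x neg by (auto simp: S_def)
  let ?g = "\<lambda>y. partial k u y * inverse (u y + \<epsilon>)"
  have inv: "((\<lambda>t. inverse (t + \<epsilon>)) has_real_derivative - (1 / (u x + \<epsilon>)\<^sup>2)) (at (u x))"
    using neg by (auto intro!: derivative_eq_intros simp: field_simps power2_eq_square)
  note chain = partial_chain[OF d(1) inv]
  show "partial k (log_height \<epsilon>) differentiable (at x)"
    by (rule differentiable_cong_open[OF _ S, of ?g])
      (auto intro!: differentiable_mult d chain simp: log_height_derivative S_def)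
  have "partial l (partial k (log_height \<epsilon>)) x = partial l ?g x"
    by (rule partial_cong_open[OF S]) (simp add: log_height_derivative S_def)
  also have "\<dots> = partial l (partial k u) x / (u x + \<epsilon>) - partial l u x * partial k u x / (u x + \<epsilon>)\<^sup>2"
    by (simp add: partial_mult d chain divide_inverse mult_ac)
  finally show "partial l (partial k (log_height \<epsilon>)) x
      = partial l (partial k u) x / (u x + \<epsilon>) - partial l u x * partial k u x / (u x + \<epsilon>)\<^sup>2" .
qed

lemma trace_second_log_height:
  assumes x: "x \<in> D" and neg: "u x + \<epsilon> < 0"
  shows "trace (inv_hessian x ** (\<chi> i j. partial i (partial j (log_height \<epsilon>)) x))
    = real CARD('n) / (u x + \<epsilon>) - gradient u x \<bullet> (inv_hessian x *v gradient u x) / (u x + \<epsilon>)\<^sup>2"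
proof -
  have "trace (inv_hessian x ** hessian u x) = real CARD('n)"
    by (simp add: inv_hessian_mult[OF x] trace_def mat_def)
  then have "(\<Sum>i\<in>UNIV. \<Sum>j\<in>UNIV. inv_hessian x $ i $ j * partial j (partial i u) x) = real CARD('n)"
    by (simp add: trace_mult hessian_nth)
  then show ?thesis
    unfolding quadratic_form_matrix
    by (simp add: trace_mult second_log_height[OF assms] right_diff_distrib sum_subtractf gradient_def
        sum_divide_distrib[symmetric] mult_ac)
qed

text \<open>In the proof \<open>w\<close> denotes the gradient of \<open>u\<close>, \<open>P\<close> the inverse of the Hessian \<open>H\<close>, and \<open>l\<close> the
  gradient of \<open>log det\<close>.  The condition \<open>\<nabla>f = 0\<close> reads \<open>l = - (n / v) w - 2 \<alpha> H G w\<close>.  The quantity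
  \<open>q = H(G w, G w)\<close>, over which there is no control, enters \<open>l \<bullet> P l\<close> with coefficient \<open>4 \<alpha>\<^sup>2\<close> and
  the contraction of the second derivatives of the energy with \<open>- 4 \<alpha>\<close>; weighted with \<open>\<alpha>\<close>, the two
  contributions cancel.  The quantity \<open>x = P(w, w)\<close> has coefficient \<open>n\<^sup>2 - n \<ge> 0\<close> and is dropped.\<close>

lemma inequality_at_maximum:
  fixes \<alpha> \<epsilon> :: real and G
  defines "n \<equiv> real CARD('n)"
  defines "f \<equiv> \<lambda>x. log_det x + n * log_height \<epsilon> x + \<alpha> * energy G x"
  assumes G: "transpose G = G" and S: "open S" "p \<in> S" "\<And>x. x \<in> S \<Longrightarrow> x \<in> D \<and> u x + \<epsilon> < 0"
    and max: "\<And>x. x \<in> S \<Longrightarrow> f x \<le> f p"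
  shows "2 * \<alpha> * trace (G ** hessian u p) * (- (u p + \<epsilon>))
    \<le> - abreu u p * (- (u p + \<epsilon>)) + n\<^sup>2 + 2 * n * \<alpha> * energy G p"
proof -
  have p: "p \<in> D" "u p + \<epsilon> < 0" using S by auto
  define v where "v = u p + \<epsilon>"
  have "v < 0" using p by (simp add: v_def)
  let ?P = "inv_hessian p" and ?H = "hessian u p" and ?w = "gradient u p" and ?l = "gradient log_det p"
  have fx: "partial k f x = partial k log_det x + n * partial k (log_height \<epsilon>) x + \<alpha> * partial k (energy G) x"
    and fd: "f differentiable (at x)" if "x \<in> S" for k x
    using S(3)[OF that] G unfolding f_def
    by (auto simp: partial_add partial_cmult log_det_derivative(1) log_height_derivative(1) energy_derivative(1)
        intro!: differentiable_add differentiable_mult)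
  note sd = differentiable_partial_log_det[OF p(1)] second_log_height(1)[OF p] second_energy(1)[OF G p(1)]
  let ?f1 = "\<lambda>k x. partial k log_det x + n * partial k (log_height \<epsilon>) x + \<alpha> * partial k (energy G) x"
  have fd2: "partial k f differentiable (at p)" for k
    by (rule differentiable_cong_open[OF _ S(1,2), of "?f1 k"]) (auto simp: fx intro!: sd differentiable_add differentiable_mult)
  have fxx: "partial l (partial k f) p = partial l (partial k log_det) p
      + n * partial l (partial k (log_height \<epsilon>)) p + \<alpha> * partial l (partial k (energy G)) p" for k l
  proof -
    have "partial l (partial k f) p = partial l (?f1 k) p"
      by (rule partial_cong_open[OF S(1,2)]) (rule fx)
    then show ?thesis by (simp add: partial_add partial_cmult sd differentiable_add differentiable_mult)
  qed
  note test = second_derivative_nonpos_at_max[OF S(1,2) fd fd2 max]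
  have "trace (?P ** (\<chi> i j. partial i (partial j f) p)) \<le> 0"
    by (intro trace_pos_def_mult_nonpos pos_def_inv_hessian p test)
  then have ineq: "trace (?P ** (\<chi> i j. partial i (partial j log_det) p))
      + n * trace (?P ** (\<chi> i j. partial i (partial j (log_height \<epsilon>)) p))
      + \<alpha> * trace (?P ** (\<chi> i j. partial i (partial j (energy G)) p)) \<le> 0"
    by (simp add: trace_mult fxx sum.distrib sum_distrib_left distrib_left mult_ac)
  have "partial k log_det p + n * (partial k u p * inverse v) + \<alpha> * partial k (energy G) p = 0" for k
    using test(1)[of k] by (simp add: fx S log_height_derivative(2)[OF p] v_def)
  moreover define c where "c = - (n / v)"
  ultimately have "?l - c *\<^sub>R ?w + \<alpha> *\<^sub>R gradient (energy G) p = 0"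
    by (simp add: vec_eq_iff gradient_def divide_inverse mult_ac)
  then have l: "?l = c *\<^sub>R ?w - (2 * \<alpha>) *\<^sub>R (?H *v (G *v ?w))"
    by (simp add: gradient_energy[OF G p(1)] algebra_simps)
  have symH: "transpose ?H = ?H"
    using pos_def[OF p(1)] by (simp add: pos_def_matrix_def)
  have PH: "?P *v (?H *v y) = y" and HP: "?H *v (?P *v y) = y" for y
    using inv_hessian_mult[OF p(1)] by (simp_all add: matrix_vector_mul_assoc)
  define x h q where "x = ?w \<bullet> (?P *v ?w)" and "h = energy G p" and "q = (G *v ?w) \<bullet> (?H *v (G *v ?w))"
  have h: "?w \<bullet> (G *v ?w) = h" "(G *v ?w) \<bullet> ?w = h"
    by (simp_all add: h_def energy_eq inner_commute)
  have hp: "(?H *v (G *v ?w)) \<bullet> (?P *v ?w) = h"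
    by (simp add: symmetric_matrix_inner[OF symH] HP h)
  have q: "(?H *v (G *v ?w)) \<bullet> (G *v ?w) = q"
    by (simp add: q_def inner_commute)
  have "?P *v ?l = c *\<^sub>R (?P *v ?w) - (2 * \<alpha>) *\<^sub>R (G *v ?w)"
    unfolding l by (simp add: matrix_vector_mult_diff_distrib matrix_vector_mult_scaleR PH)
  then have "?l \<bullet> (?P *v ?l) = (c *\<^sub>R ?w - (2 * \<alpha>) *\<^sub>R (?H *v (G *v ?w)))
      \<bullet> (c *\<^sub>R (?P *v ?w) - (2 * \<alpha>) *\<^sub>R (G *v ?w))"
    using l by simp
  also have "\<dots> = c\<^sup>2 * x - 4 * \<alpha> * c * h + 4 * \<alpha>\<^sup>2 * q"
    by (simp add: inner_diff_left inner_diff_right h hp q flip: x_def)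
      (simp add: power2_eq_square algebra_simps)
  finally have lPl: "?l \<bullet> (?P *v ?l) = n\<^sup>2 * x / v\<^sup>2 + 4 * \<alpha> * n * h / v + 4 * \<alpha>\<^sup>2 * q"
    by (simp add: c_def power_divide)
  have Gl: "(G *v ?w) \<bullet> ?l = - (n / v) * h - 2 * \<alpha> * q"
    unfolding l by (simp add: inner_diff_right h q_def c_def)
  have "abreu u p + (n\<^sup>2 * x / v\<^sup>2 + 4 * \<alpha> * n * h / v + 4 * \<alpha>\<^sup>2 * q) + n * (n / v - x / v\<^sup>2)
      + \<alpha> * (2 * trace (G ** ?H) + 2 * (- (n / v) * h - 2 * \<alpha> * q)) \<le> 0"
    using ineq abreu_log_det[OF p(1)] trace_second_log_height[OF p] trace_second_energy[OF G p(1)]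
    by (simp add: lPl Gl x_def v_def n_def)
  then have "abreu u p + (n\<^sup>2 - n) * x / v\<^sup>2 + 2 * \<alpha> * n * h / v + n\<^sup>2 / v + 2 * \<alpha> * trace (G ** ?H) \<le> 0"
    by (simp add: power2_eq_square algebra_simps diff_divide_distrib)
  moreover have "(n\<^sup>2 - n) * x / v\<^sup>2 \<ge> 0"
  proof -
    have "x \<ge> 0"
      using pos_def_inv_hessian[OF p(1)] unfolding x_def pos_def_matrix_def
      by (cases "?w = 0") (auto simp: less_imp_le)
    moreover have "n \<ge> 1" by (simp add: n_def Suc_leI)
    then have "n\<^sup>2 \<ge> n" by (simp add: power2_eq_square)
    ultimately show ?thesis by simp
  qed
  ultimately have "2 * \<alpha> * trace (G ** ?H) \<le> - abreu u p - n\<^sup>2 / v - 2 * \<alpha> * n * h / v"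
    by linarith
  then have "2 * \<alpha> * trace (G ** ?H) * (- v) \<le> (- abreu u p - n\<^sup>2 / v - 2 * \<alpha> * n * h / v) * (- v)"
    using \<open>v < 0\<close> by (intro mult_right_mono) auto
  also have "\<dots> = - abreu u p * (- v) + n\<^sup>2 + 2 * n * \<alpha> * h"
    using \<open>v < 0\<close> by (simp add: field_simps)
  finally show ?thesis by (simp add: v_def h_def)
qed

lemma continuous_on_det_hessian: "continuous_on D (\<lambda>x. det (hessian u x))"
  by (intro continuous_at_imp_continuous_on ballI differentiable_imp_continuous_within partial_det(1))
    (simp add: hessian_nth differentiable_partials)

text \<open>The function \<open>\<psi> = (det u_ij)^(1/n) (-(u + \<epsilon>)) exp (h / C)\<close> is continuous on the compact
  set \<open>u \<le> -\<epsilon>\<close> and vanishes where \<open>u = -\<epsilon>\<close>, so its maximum is attained inside.  There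
  \<open>n log \<psi>\<close> is the function of lemma \<open>inequality_at_maximum\<close> with \<open>\<alpha> = n / C\<close>.\<close>

lemma determinant_bound_sublevel:
  fixes C a M :: real and G
  defines "n \<equiv> real CARD('n)"
  assumes D: "bounded D" "continuous_on (closure D) u" "\<And>x. x \<in> frontier D \<Longrightarrow> u x = 0"
    and G: "pos_def_matrix G" "det G = 1"
    and C: "C > 0" "\<And>y. y \<in> D \<Longrightarrow> energy G y \<le> C"
    and a: "a \<ge> 0" "\<And>y. y \<in> D \<Longrightarrow> - a \<le> abreu u y"
    and M: "\<And>y. y \<in> D \<Longrightarrow> - u y \<le> M"
    and \<epsilon>: "\<epsilon> > 0" and x: "x \<in> D" "u x + \<epsilon> < 0"
  shows "det (hessian u x) powr (1 / n) * (- (u x + \<epsilon>)) \<le> exp 1 * C * (3 / 2 + a * M / (2 * n\<^sup>2))"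
proof -
  have n: "n > 0" by (simp add: n_def)
  define R where "R y = det (hessian u y) powr (1 / n) * (- (u y + \<epsilon>))" for y
  define \<psi> where "\<psi> y = R y * exp (energy G y / C)" for y
  define K where "K = {y \<in> closure D. u y \<le> - \<epsilon>}"
  have KD: "K \<subseteq> D"
  proof
    fix y assume y: "y \<in> K"
    then have "y \<notin> frontier D" using D(3)[of y] \<epsilon> by (auto simp: K_def)
    then show "y \<in> D" using y open_domain by (simp add: K_def frontier_def interior_open)
  qed
  have "K = closure D \<inter> u -` {..- \<epsilon>}" by (auto simp: K_def)
  then have "closed K"
    using continuous_closed_preimage[OF D(2) closed_closure closed_atMost] by simp
  moreover have "bounded K" using D(1) KD bounded_subset by blast
  ultimately have "compact K" by (simp add: compact_eq_bounded_closed)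
  have xK: "x \<in> K" using x closure_subset by (auto simp: K_def)
  have detpos: "det (hessian u y) > 0" if "y \<in> D" for y
    using that by (intro pos_def_det_pos pos_def)
  have symG: "transpose G = G" using G by (simp add: pos_def_matrix_def)
  have "continuous_on D (energy G)"
    by (intro continuous_at_imp_continuous_on ballI differentiable_imp_continuous_within energy_derivative(1) symG)
  then have "continuous_on D \<psi>"
    unfolding \<psi>_def R_def using detpos C(1)
    by (intro continuous_intros continuous_on_powr continuous_on_det_hessian continuous_on_potential)
      (auto simp: less_imp_neq[symmetric] dest: detpos)
  then have "continuous_on K \<psi>" using KD continuous_on_subset by blast
  then obtain p where p: "p \<in> K" and max: "\<And>y. y \<in> K \<Longrightarrow> \<psi> y \<le> \<psi> p"
    using continuous_attains_sup[OF \<open>compact K\<close>, of \<psi>] xK by blast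
  have pD: "p \<in> D" using p KD by blast
  have Rpos: "R y > 0 \<longleftrightarrow> u y + \<epsilon> < 0" if "y \<in> D" for y
    using detpos[OF that] by (auto simp: R_def zero_less_mult_iff)
  have "\<psi> x > 0" using x Rpos by (simp add: \<psi>_def)
  then have "\<psi> p > 0" using max[OF xK] by linarith
  then have neg: "u p + \<epsilon> < 0" using Rpos[OF pD] by (simp add: \<psi>_def zero_less_mult_iff)
  define S where "S = {y \<in> D. u y + \<epsilon> < 0}"
  define f where "f y = log_det y + n * log_height \<epsilon> y + n / C * energy G y" for y
  have f: "f y = n * ln (\<psi> y)" if "y \<in> S" for y
  proof -
    have y: "y \<in> D" "u y + \<epsilon> < 0" using that by (auto simp: S_def)
    have "ln (\<psi> y) = ln (det (hessian u y)) / n + ln (- (u y + \<epsilon>)) + energy G y / C"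
      using detpos[OF y(1)] y(2) unfolding \<psi>_def R_def
      by (simp add: ln_mult ln_powr zero_less_mult_iff)
    then show ?thesis
      using n by (simp add: f_def log_det_def log_height_def algebra_simps)
  qed
  have fmax: "f y \<le> f p" if "y \<in> S" for y
  proof -
    have "y \<in> K" using that closure_subset by (auto simp: S_def K_def)
    moreover have "\<psi> y > 0" using that Rpos by (auto simp: S_def \<psi>_def)
    ultimately have "ln (\<psi> y) \<le> ln (\<psi> p)"
      using max by (simp add: \<open>\<psi> p > 0\<close>)
    then show ?thesis
      using f that pD neg n by (simp add: S_def mult_left_mono)
  qed
  define tr where "tr = trace (G ** hessian u p)"
  have "2 * (n / C) * tr * (- (u p + \<epsilon>))
      \<le> - abreu u p * (- (u p + \<epsilon>)) + n\<^sup>2 + 2 * n * (n / C) * energy G p"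
    unfolding tr_def n_def using fmax open_sublevel pD neg
    by (intro inequality_at_maximum[OF symG, of S]) (auto simp: S_def f_def n_def)
  also have "- abreu u p * (- (u p + \<epsilon>)) \<le> a * M"
    using a(1) a(2)[OF pD] M[OF pD] neg \<epsilon> by (intro mult_mono) auto
  also have "2 * n * (n / C) * energy G p \<le> 2 * n * (n / C) * C"
    using C n pD by (intro mult_left_mono) auto
  finally have 1: "2 * (n / C) * tr * (- (u p + \<epsilon>)) \<le> a * M + n\<^sup>2 + 2 * n * (n / C) * C"
    by simp
  have "n * det (hessian u p) powr (1 / n) \<le> tr"
    using arith_geom_mean_trace_mult[OF G(1) pos_def[OF pD]] G(2) by (simp add: tr_def n_def)
  then have "2 * (n / C) * (n * det (hessian u p) powr (1 / n)) * (- (u p + \<epsilon>)) \<le> 2 * (n / C) * tr * (- (u p + \<epsilon>))"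
    using n C(1) neg by (intro mult_right_mono mult_left_mono) auto
  then have "2 * n\<^sup>2 / C * R p \<le> 2 * (n / C) * tr * (- (u p + \<epsilon>))"
    by (simp add: R_def power2_eq_square mult_ac)
  with 1 have "2 * n\<^sup>2 / C * R p \<le> a * M + 3 * n\<^sup>2"
    using C(1) by (simp add: power2_eq_square)
  then have Rp: "R p \<le> C * (3 / 2 + a * M / (2 * n\<^sup>2))"
    using C(1) n by (simp add: field_simps)
  have "R x * 1 \<le> \<psi> x"
    unfolding \<psi>_def using Rpos[OF x(1)] x(2) energy_nonneg[OF G(1)] C(1)
    by (intro mult_left_mono) (auto simp: less_imp_le)
  also have "\<psi> x \<le> \<psi> p" by (rule max[OF xK])
  also have "\<psi> p \<le> R p * exp 1"
    unfolding \<psi>_def using Rpos[OF pD] neg C pD by (intro mult_left_mono) (auto simp: less_imp_le)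
  also have "\<dots> \<le> C * (3 / 2 + a * M / (2 * n\<^sup>2)) * exp 1"
    using Rp by (intro mult_right_mono) auto
  finally show ?thesis by (simp add: R_def mult_ac)
qed

lemma determinant_bound:
  fixes C a M :: real and G
  defines "n \<equiv> real CARD('n)"
  assumes D: "bounded D" "continuous_on (closure D) u" "\<And>x. x \<in> frontier D \<Longrightarrow> u x = 0"
    and G: "pos_def_matrix G" "det G = 1"
    and C: "C > 0" "\<And>y. y \<in> D \<Longrightarrow> energy G y \<le> C"
    and a: "a \<ge> 0" "\<And>y. y \<in> D \<Longrightarrow> - a \<le> abreu u y"
    and M: "\<And>y. y \<in> D \<Longrightarrow> - u y \<le> M"
    and x: "x \<in> D" "u x < 0"
  shows "det (hessian u x) powr (1 / n) * (- u x) \<le> exp 1 * C * (3 / 2 + a * M / (2 * n\<^sup>2))"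
proof (rule tendsto_upperbound)
  show "((\<lambda>\<epsilon>. det (hessian u x) powr (1 / n) * (- (u x + \<epsilon>)))
      \<longlongrightarrow> det (hessian u x) powr (1 / n) * (- u x)) (at_right 0)"
    by (auto intro!: tendsto_eq_intros)
  show "\<forall>\<^sub>F \<epsilon> in at_right 0. det (hessian u x) powr (1 / n) * (- (u x + \<epsilon>))
      \<le> exp 1 * C * (3 / 2 + a * M / (2 * n\<^sup>2))"
    unfolding eventually_at_right_field n_def using x determinant_bound_sublevel[OF D G C a M _ x(1)]
    by (intro exI[of _ "- u x"]) auto
qed simp

section \<open>A lower bound for the gradient supremum, uniform in the metric\<close>

text \<open>A vector orthogonal to all gradients would be a direction in which \<open>u\<close> is constant,
  hence a null vector of the Hessian.\<close>

lemma span_gradient: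
  assumes "D \<noteq> {}"
  shows "span (gradient u ` D) = UNIV"
proof (rule ccontr)
  assume "span (gradient u ` D) \<noteq> UNIV"
  then obtain v where v: "v \<noteq> 0" "\<And>y. y \<in> D \<Longrightarrow> v \<bullet> gradient u y = 0"
    using span_not_UNIV_orthogonal by (metis imageI span_base)
  obtain x where x: "x \<in> D" using assms by blast
  have "(\<Sum>j\<in>UNIV. hessian u x $ i $ j * v $ j) = 0" for i
  proof -
    have "partial i (\<lambda>y. \<Sum>j\<in>UNIV. v $ j * partial j u y) x = partial i (\<lambda>y. 0) x"
      using v(2) by (intro partial_cong_open[OF open_domain x]) (simp add: inner_vec_def gradient_def)
    then show ?thesis
      by (simp add: partial_sum partial_cmult partial_const differentiable_partials[OF x] hessian_nth mult.commute)
  qed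
  then have "hessian u x *v v = 0"
    by (simp add: vec_eq_iff matrix_vector_mult_def)
  then show False
    using pos_def[OF x] v(1) unfolding pos_def_matrix_def by (metis inner_zero_right less_irrefl)
qed

text \<open>The vectors on which all quadratic forms \<open>G\<close> are bounded by a fixed multiple
  of the supremum of the energy form a subspace.  It contains the gradients of \<open>u\<close>, hence every
  vector, in particular the standard basis.  Summing over that basis bounds \<open>tr G\<close>, which is at least
  \<open>n\<close> when \<open>det G = 1\<close>.\<close>

lemma energy_uniform_lower_bound:
  assumes "D \<noteq> {}"
  obtains c where "c > 0"
    "\<And>G B. pos_def_matrix G \<Longrightarrow> det G = 1 \<Longrightarrow> (\<And>y. y \<in> D \<Longrightarrow> energy G y \<le> B) \<Longrightarrow> c \<le> B"
proof -
  define bounding where "bounding G B \<longleftrightarrow> pos_def_matrix G \<and> (\<forall>y\<in>D. energy G y \<le> B)" for G B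
  have B0: "B \<ge> 0" if "bounding G B" for G B
  proof -
    obtain y where "y \<in> D" using assms by blast
    then have "0 \<le> energy G y" "energy G y \<le> B"
      using that energy_nonneg[of G y] by (auto simp: bounding_def)
    then show ?thesis by simp
  qed
  define V where "V = {v. \<exists>K\<ge>0. \<forall>G B. bounding G B \<longrightarrow> v \<bullet> (G *v v) \<le> K * B}"
  have "subspace V"
    unfolding subspace_def
  proof (intro conjI ballI allI)
    show "0 \<in> V" unfolding V_def using B0 by (auto intro!: exI[of _ 0])
  next
    fix v w assume "v \<in> V" "w \<in> V"
    then obtain K L where K: "K \<ge> 0" "\<And>G B. bounding G B \<Longrightarrow> v \<bullet> (G *v v) \<le> K * B"
      and L: "L \<ge> 0" "\<And>G B. bounding G B \<Longrightarrow> w \<bullet> (G *v w) \<le> L * B"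
      unfolding V_def by auto
    have "(v + w) \<bullet> (G *v (v + w)) \<le> (2 * K + 2 * L) * B" if GB: "bounding G B" for G B
    proof -
      have "(v - w) \<bullet> (G *v (v - w)) \<ge> 0"
        using GB by (cases "v = w") (auto simp: bounding_def pos_def_matrix_def less_imp_le)
      then have "(v + w) \<bullet> (G *v (v + w)) \<le> 2 * (v \<bullet> (G *v v)) + 2 * (w \<bullet> (G *v w))"
        by (simp add: matrix_vector_mult_diff_distrib matrix_vector_right_distrib
            inner_diff_left inner_diff_right inner_add_left inner_add_right)
      then show ?thesis using K(2)[OF GB] L(2)[OF GB] by (simp add: algebra_simps)
    qed
    then show "v + w \<in> V"
      unfolding V_def using K(1) L(1) by (intro CollectI exI[of _ "2 * K + 2 * L"]) auto
  next
    fix c :: real and v assume "v \<in> V"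
    then obtain K where K: "K \<ge> 0" "\<And>G B. bounding G B \<Longrightarrow> v \<bullet> (G *v v) \<le> K * B"
      unfolding V_def by auto
    have "(c *\<^sub>R v) \<bullet> (G *v (c *\<^sub>R v)) \<le> (c\<^sup>2 * K) * B" if GB: "bounding G B" for G B
      using mult_left_mono[OF K(2)[OF GB], of "c\<^sup>2"]
      by (simp add: matrix_vector_mult_scaleR power2_eq_square mult_ac)
    then show "c *\<^sub>R v \<in> V"
      unfolding V_def using K(1) by (intro CollectI exI[of _ "c\<^sup>2 * K"]) auto
  qed
  moreover have "gradient u ` D \<subseteq> V"
    unfolding V_def bounding_def by (auto intro!: exI[of _ 1] simp: energy_eq)
  ultimately have "V = UNIV"
    using span_minimal[of "gradient u ` D" V] span_gradient[OF assms] by auto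
  then have "\<forall>k. \<exists>K\<ge>0. \<forall>G B. bounding G B \<longrightarrow> axis k 1 \<bullet> (G *v axis k 1) \<le> K * B"
    unfolding V_def by blast
  then obtain K where K: "\<And>k. K k \<ge> 0" "\<And>k G B. bounding G B \<Longrightarrow> axis k 1 \<bullet> (G *v axis k 1) \<le> K k * B"
    by metis
  \<comment> \<open>The summand 1 makes \<open>s\<close> positive, so that it can be divided by.\<close>
  define s where "s = 1 + (\<Sum>k\<in>UNIV. K k)"
  have s: "s > 0" using K(1) by (simp add: s_def add_pos_nonneg sum_nonneg)
  show thesis
  proof (rule that[of "real CARD('n) / s"])
    show "real CARD('n) / s > 0" using s by simp
    fix G B assume G: "pos_def_matrix G" "det G = 1" and B: "\<And>y. y \<in> D \<Longrightarrow> energy G y \<le> B"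
    have GB: "bounding G B" using G B by (simp add: bounding_def)
    have "real CARD('n) \<le> trace G"
      using arith_geom_mean_pos_def[OF G(1)] G(2) by simp
    also have "trace G = (\<Sum>k\<in>UNIV. axis k 1 \<bullet> (G *v axis k 1))"
      by (simp add: trace_def inner_axis' matrix_vector_mult_basis column_def)
    also have "\<dots> \<le> (\<Sum>k\<in>UNIV. K k * B)"
      by (intro sum_mono K(2) GB)
    also have "\<dots> \<le> s * B"
      using B0[OF GB] by (simp add: s_def sum_distrib_right distrib_right)
    finally show "real CARD('n) / s \<le> B"
      using s by (simp add: pos_divide_le_eq mult.commute)
  qed
qed

end

section \<open>The determinant estimate\<close>

theorem theorem6:
  fixes D :: "(real ^ 'n) set" and u A :: "real ^ 'n \<Rightarrow> real"
  assumes "open D" and "connected D" and "D \<noteq> {}" and "bounded D"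
    and "smooth_boundary D"
    and "smooth_up_to_boundary D u"
    and "\<And>x y. closed_segment x y \<subseteq> D \<Longrightarrow> convex_on (closed_segment x y) u"
    and "\<And>x. x \<in> D \<Longrightarrow> pos_def_matrix (hessian u x)"
    and "\<And>x. x \<in> D \<Longrightarrow> abreu u x = A x"
    and "\<And>x. x \<in> D \<Longrightarrow> u x < 0"
    and "\<And>x. x \<in> frontier D \<Longrightarrow> u x = 0"
  shows "let n = real CARD('n);
             C = min_grad_sup D u;
             a = max 0 (- (INF x\<in>D. ereal (A x)));
             M = (SUP x\<in>D. ereal (- u x))
         in \<forall>x\<in>D. ereal (det (hessian u x) powr (1 / n))
              \<le> (ereal (5 / 2) + a * M / ereal (2 * n)) * ereal (exp 1) * C * ereal (inverse (- u x))"
  unfolding Let_def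
proof
  fix x assume x: "x \<in> D"
  interpret convex_potential D u
    using assms(1,6,8) by unfold_locales (auto simp: smooth_up_to_boundary_def)
  define n where "n = real CARD('n)"
  have n: "n \<ge> 1" by (simp add: n_def Suc_leI)
  define C where "C = min_grad_sup D u"
  define a where "a = max 0 (- (INF x\<in>D. ereal (A x)))"
  define M where "M = (SUP x\<in>D. ereal (- u x))"
  define K where "K = ereal (5 / 2) + a * M / ereal (2 * n)"
  define J where "J = det (hessian u x) powr (1 / n)"
  have cont: "continuous_on (closure D) u"
    using assms(6) by (simp add: smooth_up_to_boundary_def)
  have ux: "- u x > 0" using assms(10)[OF x] by simp
  have bound_iff: "grad_sup D u g \<le> ereal B \<longleftrightarrow> (\<forall>y\<in>D. energy (matrix_inv g) y \<le> B)" for g B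
    by (simp add: grad_sup_def SUP_le_iff energy_def)
  have inv: "pos_def_matrix (matrix_inv g)" "det (matrix_inv g) = 1"
    if "pos_def_matrix g" "det g = 1" for g :: "real ^ 'n ^ 'n"
    using pos_def_matrix_inv[OF that(1)] arg_cong[OF pos_def_inverse_mult(1)[OF that(1)], of det] that
    by (simp_all add: det_mul)
  obtain M' where M': "M = ereal M'" "\<And>y. y \<in> D \<Longrightarrow> - u y \<le> M'" "M' > 0"
  proof -
    have "compact (closure D)" using assms(4) by simp
    then have "bounded (u ` closure D)" using cont compact_continuous_image compact_imp_bounded by blast
    then obtain B where B: "\<And>y. y \<in> D \<Longrightarrow> \<bar>u y\<bar> \<le> B"
      unfolding bounded_iff using closure_subset by (metis image_eqI real_norm_def subsetD)
    have "M \<le> ereal B" unfolding M_def using B by (intro SUP_least) (fastforce simp: abs_le_iff)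
    moreover have ge: "ereal (- u y) \<le> M" if "y \<in> D" for y
      unfolding M_def using that by (rule SUP_upper)
    ultimately obtain M' where "M = ereal M'"
      using ge[OF x] by (cases M) auto
    then show thesis using that ge ux x by (metis ereal_less_eq(3) less_le_trans)
  qed
  have apos: "a \<ge> 0" by (simp add: a_def)
  obtain c where c: "c > 0"
    "\<And>G B. pos_def_matrix G \<Longrightarrow> det G = 1 \<Longrightarrow> (\<And>y. y \<in> D \<Longrightarrow> energy G y \<le> B) \<Longrightarrow> c \<le> B"
    using energy_uniform_lower_bound[OF assms(3)] by metis
  \<comment> \<open>Positivity of \<open>C\<close> keeps \<open>\<infinity> * C\<close> from being 0 when \<open>a = \<infinity>\<close>.\<close>
  have "ereal c \<le> C"
    unfolding C_def min_grad_sup_def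
  proof (intro INF_greatest)
    fix g :: "real ^ 'n ^ 'n" assume "g \<in> {g. pos_def_matrix g \<and> det g = (1::real)}"
    then have g: "pos_def_matrix g" "det g = 1" by auto
    show "ereal c \<le> grad_sup D u g"
    proof (rule ereal_le_real)
      fix B assume "grad_sup D u g \<le> ereal B"
      then show "ereal c \<le> ereal B"
        using c(2)[OF inv[OF g]] by (simp add: bound_iff)
    qed
  qed
  then have Cpos: "C > 0" using c(1) by (metis ereal_less(2) less_le_trans)
  show "ereal (det (hessian u x) powr (1 / real CARD('n)))
      \<le> (ereal (5 / 2) + max 0 (- (INF x\<in>D. ereal (A x))) * (SUP x\<in>D. ereal (- u x)) / ereal (2 * real CARD('n)))
        * ereal (exp 1) * min_grad_sup D u * ereal (inverse (- u x))"
    unfolding n_def[symmetric] C_def[symmetric] a_def[symmetric] M_def[symmetric] K_def[symmetric]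
      J_def[symmetric]
  proof (cases "a = \<infinity>")
    case True
    then have "K = \<infinity>" using M' n by (simp add: K_def)
    then have "K * ereal (exp 1) * C * ereal (inverse (- u x)) = \<infinity>"
      using Cpos ux by (simp add: ereal_mult_eq_PInfty)
    then show "ereal J \<le> K * ereal (exp 1) * C * ereal (inverse (- u x))"
      by (metis ereal_less_eq(1))
  next
    case False
    then obtain a' where a': "a = ereal a'" "a' \<ge> 0" using apos by (cases a) auto
    have A: "- a' \<le> abreu u y" if y: "y \<in> D" for y
    proof -
      have "(INF x\<in>D. ereal (A x)) \<le> ereal (A y)" using y by (rule INF_lower)
      moreover have "- (INF x\<in>D. ereal (A x)) \<le> ereal a'" using a'(1) by (metis a_def max.cobounded2)
      ultimately have "- ereal (A y) \<le> ereal a'" by (metis ereal_minus_le_minus order_trans)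
      then show ?thesis using assms(9)[OF y] by simp
    qed
    define k where "k = 5 / 2 + a' * M' / (2 * n)"
    have K: "K = ereal k" using n by (simp add: K_def k_def a' M')
    have kpos: "k > 0" using a' M' n by (simp add: k_def add_pos_nonneg)
    have "3 / 2 + a' * M' / (2 * n\<^sup>2) \<le> k"
    proof -
      have "2 * n \<le> 2 * n\<^sup>2" using n by (simp add: power2_eq_square)
      then have "a' * M' / (2 * n\<^sup>2) \<le> a' * M' / (2 * n)"
        using a' M' n by (intro divide_left_mono) auto
      then show ?thesis by (simp add: k_def)
    qed
    then have le: "J * (- u x) \<le> exp 1 * B * k"
      if g: "pos_def_matrix g" "det g = 1" and B: "grad_sup D u g \<le> ereal B" for g B
    proof -
      have B': "\<And>y. y \<in> D \<Longrightarrow> energy (matrix_inv g) y \<le> B" using B by (simp add: bound_iff)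
      then have "B > 0" using c inv[OF g] by (metis less_le_trans)
      have "J * (- u x) \<le> exp 1 * B * (3 / 2 + a' * M' / (2 * n\<^sup>2))"
        unfolding J_def n_def
        using determinant_bound[OF assms(4) cont assms(11) inv[OF g] \<open>B > 0\<close> B' a'(2) A M'(2) x] ux by simp
      also have "\<dots> \<le> exp 1 * B * k"
        using \<open>B > 0\<close> \<open>3 / 2 + a' * M' / (2 * n\<^sup>2) \<le> k\<close> by (intro mult_left_mono) auto
      finally show ?thesis .
    qed
    \<comment> \<open>Solving the estimate for \<open>C_g\<close> gives a lower bound independent of \<open>g\<close>, which passes to
        the infimum.\<close>
    define r where "r = J * (- u x) / (exp 1 * k)"
    have "ereal r \<le> C"
      unfolding C_def min_grad_sup_def
    proof (intro INF_greatest)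
      fix g :: "real ^ 'n ^ 'n" assume "g \<in> {g. pos_def_matrix g \<and> det g = (1::real)}"
      then have g: "pos_def_matrix g" "det g = 1" by auto
      show "ereal r \<le> grad_sup D u g"
      proof (rule ereal_le_real)
        fix B assume "grad_sup D u g \<le> ereal B"
        from le[OF g this] have "r \<le> B"
          unfolding r_def using kpos by (subst pos_divide_le_eq) (simp_all add: mult_ac)
        then show "ereal r \<le> ereal B" by simp
      qed
    qed
    then have "ereal (k * exp 1) * ereal r * ereal (inverse (- u x)) \<le> ereal (k * exp 1) * C * ereal (inverse (- u x))"
      using kpos ux by (intro ereal_mult_right_mono ereal_mult_left_mono) auto
    moreover have "ereal (k * exp 1) * ereal r * ereal (inverse (- u x)) = ereal J"
      using kpos ux by (simp add: r_def field_simps)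
    ultimately show "ereal J \<le> K * ereal (exp 1) * C * ereal (inverse (- u x))"
      by (simp add: K)
  qed
qed

end
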